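(* The algebra $\mathcal E=E_{q,p}(\widehat{\mathfrak{gl}}_N)$ is an $H$-algebra with bigrading $\mathcal E=\bigoplus_{\alpha,\beta\in H^*}\mathcal E_{\alpha,\beta}$, $$\mathcal E_{\alpha,\beta}=\{a\in\mathcal E\mid q^{P+h}aq^{-(P+h)}=q^{\langle\alpha,P+h\rangle}a,\ q^Paq^{-P}=q^{\langle\beta,P\rangle}a\ \ \forall\,P+h,P\in H\},$$ and moment maps $\mu_l,\mu_r:\mathbb F\to\mathcal E_{0,0}$ defined by $\mu_l(\hat f)=f(P+h,p)\in\mathbb F[[p]]$, $\mu_r(\hat f)=f(P,p^* )\in\mathbb F[[p]]$. Moreover $\bar L_{ij,n}\in\mathcal E_{-Q_{\bar\epsilon_i},-Q_{\bar\epsilon_j}}$ for all $1\le i,j\le N$, $n\in\mathbb Z$.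
   Context: **Notation.** $N\ge2$; $\epsilon_1,\dots,\epsilon_N$ is an orthonormal basis of $\mathbb R^N$, $\bar\epsilon_j=\epsilon_j-\frac1N\sum_k\epsilon_k$, $(\bar\epsilon_j,\bar\epsilon_k)=\delta_{jk}-\frac1N$; $\alpha_j=\bar\epsilon_j-\bar\epsilon_{j+1}$; $\bar{\mathfrak h}^*=\bigoplus_{j<N}\mathbb C\alpha_j$, with dual $\bar{\mathfrak h}$ spanned by $h_{\bar\epsilon_j}$, $\langle\bar\epsilon_i,h_{\bar\epsilon_j}\rangle=(\bar\epsilon_i,\bar\epsilon_j)$. Dynamical parameters $P_{\bar\epsilon_j}$ and duals $Q_{\bar\epsilon_j}$: $[P_{\bar\epsilon_j},Q_{\bar\epsilon_k}]=(\bar\epsilon_j,\bar\epsilon_k)$, other commutators zero; $h_\alpha,P_\alpha,Q_\alpha$ linear in $\alpha$; $(P+h)_\alpha=P_\alpha+h_\alpha$. $H=\bar{\mathfrak h}\oplus\sum_j\mathbb CP_{\bar\epsilon_j}\oplus\mathbb Cc$, $H^*=\bar{\mathfrak h}^*\oplus\sum_j\mathbb CQ_{\bar\epsilon_j}\oplus\mathbb C\Lambda_0$, $\langle Q_\alpha,P_\beta\rangle=(\alpha,\beta)=\langle\alpha,h_\beta\rangle$, $\langle\Lambda_0,c\rangle=1$, other pairings $0$. $\mathbb F=\mathcal M_{H^*}$: field of meromorphic functions on $H^*$, elements $f(P+h,P)$. In the grading, "$P+h$" ranges over linear combinations of the $(P+h)_{\bar\epsilon_j}$ and "$P$" over those of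 the $P_{\bar\epsilon_j}$; so the first degree matters only through its values on the $(P+h)_{\bar\epsilon_j}$ and the second through its values on the $P_{\bar\epsilon_j}$. In the moment maps, $\hat f$ is a function $f$ of one set of dynamical variables (possibly depending on the elliptic nome as a parameter), evaluated at $(P+h,p)$, respectively $(P,p^* )$. $g(P-\langle\mu,P\rangle)$ means each $P_\beta$ is replaced by $P_\beta-\langle\mu,P_\beta\rangle$; similarly for $P+h$. $q=e^\hbar$, $p$ indeterminates, $p^*=pq^{-2c}$. $(x;q_1,\dots,q_k)_\infty=\prod_{n_i\ge0}(1-xq_1^{n_1}\cdots q_k^{n_k})$, $\Theta_p(z)=(z;p)_\infty(p/z;p)_\infty(p;p)_\infty$, $\{z\}=(z;p,q^{2N})_\infty$. **$H$-algebra.** A unital associative algebra $A=\bigoplus_{\alpha,\beta\in H^*}A_{\alpha\beta}$ with algebra embeddings $\mu_l,\mu_r:\mathcal M_{H^*}\to A_{00}$ such that $\mu_l(\hat f)a=a\mu_l(T_\alpha\hat f)$, $\mu_r(\hat f)a=a\mu_r(T_\beta\hat f)$ for $a\in A_{\alpha\beta}$, where $(T_\alpha\hat f)(\lambda)=\hat f(\lambda+\alpha)$. **$R$-matrix.** $V=\bigoplus_{i=1}^N\mathbb Cv_i$, $E_{ij}v_k=\delta_{jk}v_i$; with $s_{j,l}=s_{\bar\epsilon_j}-s_{\bar\epsilon_l}$, $R^+(z,s)=\rho^+(z)\big[\sum_jE_{jj}\otimes E_{jj}+\sum_{j<l}(b(z,s_{j,l})E_{jj}\otimes E_{ll}+\bar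 b(z)E_{ll}\otimes E_{jj}+c(z,s_{j,l})E_{jl}\otimes E_{lj}+\bar c(z,s_{j,l})E_{lj}\otimes E_{jl})\big]$, $\rho^+(z)=q^{-\frac{N-1}N}\frac{\{q^2z\}\{q^{2N-2}z\}\{p/z\}\{pq^{2N}/z\}}{\{z\}\{q^{2N}z\}\{pq^2/z\}\{pq^{2N-2}/z\}}$, $b(z,s)=q\frac{\Theta_p(q^{2s+2})\Theta_p(q^{2s-2})\Theta_p(z)}{\Theta_p(q^{2s})^2\Theta_p(q^2z)}$, $\bar b(z)=q\frac{\Theta_p(z)}{\Theta_p(q^2z)}$, $c(z,s)=\frac{\Theta_p(q^2)\Theta_p(q^{2s}z)}{\Theta_p(q^{2s})\Theta_p(q^2z)}$, $\bar c(z,s)=c(z,-s)$; regarded as a formal Laurent series in $z$ over $\mathbb F[[p]]$, the $p$-independent factors being expanded in nonnegative powers of $z$. $R^{+*}=R^+|_{p\to p^*}$. **$E_{q,p}(\widehat{\mathfrak{gl}}_N)$.** The topological ($p$-adic) algebra over $\mathbb F[[p]]$ generated by $\bar L_{ij,n}$ $(1\le i,j\le N,n\in\mathbb Z)$, $\widehat d$ and central $q^{\pm c/2}$; with $L^+_{ij}(z)=\sum_np^{\max(n,0)}\bar L_{ij,n}z^{-n}$, $L^+(z)=\sum_{ij}E_{ij}L^+_{ij}(z)$, the relations are $R^{+(12)}(z_1/z_2,P+h)L^{+(1)}(z_1)L^{+(2)}(z_2)=L^{+(2)}(z_2)L^{+(1)}(z_1)R^{+*(12)}(z_1/z_2,P)$,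 $g(P+h)\bar L_{ij,n}=\bar L_{ij,n}g(P+h-\langle Q_{\bar\epsilon_i},P+h\rangle)$, $g(P)\bar L_{ij,n}=\bar L_{ij,n}g(P-\langle Q_{\bar\epsilon_j},P\rangle)$, $[\widehat d,L^+(z)]=-z\partial_zL^+(z)$ ($\widehat d$ commutes with $\mathbb F$).
   Formalization: The direct sum is taken in the p-adically completed sense (each element is uniquely a convergent sum of homogeneous components), since the algebraic direct sum fails: the sum of p^n L_{11,0}^n has infinitely many nonzero components. *)

theory Defs
  imports "HOL-Complex_Analysis.Complex_Analysis" "HOL-Library.Poly_Mapping"
begin

no_notation fps_nth (infixl \<open>$\<close> 75)
no_notation fls_nth (infixl \<open>$$\<close> 75)

class complex_normed_space = real_normed_vector +
  fixes cscale :: "complex \<Rightarrow> 'a \<Rightarrow> 'a"  (infixr \<open>*\<^sub>c\<close> 75)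
  assumes cscale_add_right: "a *\<^sub>c (x + y) = a *\<^sub>c x + a *\<^sub>c y"
    and cscale_add_left: "(a + b) *\<^sub>c x = a *\<^sub>c x + b *\<^sub>c x"
    and cscale_cscale: "a *\<^sub>c b *\<^sub>c x = (a * b) *\<^sub>c x"
    and cscale_of_real: "of_real r *\<^sub>c x = r *\<^sub>R x"
    and norm_cscale: "norm (a *\<^sub>c x) = norm a * norm x"

instantiation prod :: (complex_normed_space, complex_normed_space) complex_normed_space
begin
definition cscale_prod_def: "c *\<^sub>c p = (c *\<^sub>c fst p, c *\<^sub>c snd p)"
instance
proof
  fix a :: complex and x :: "'a \<times> 'b"
  show "norm (a *\<^sub>c x) = norm a * norm x"
    by (cases x) (simp add: cscale_prod_def norm_Pair norm_cscale power_mult_distrib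
        real_sqrt_mult flip: distrib_left)
qed (auto simp: cscale_prod_def cscale_add_right cscale_add_left cscale_cscale cscale_of_real prod_eq_iff)
end

instantiation complex :: complex_normed_space
begin
definition cscale_complex_def: "c *\<^sub>c (z :: complex) = c * z"
instance by standard (auto simp: cscale_complex_def algebra_simps norm_mult scaleR_conv_of_real)
end

lemma cscale_zero [simp]: "0 *\<^sub>c x = (0 :: 'a :: complex_normed_space)" "c *\<^sub>c (0::'a) = 0"
  using norm_cscale[of 0 x] norm_cscale[of c "0::'a"] by auto

lemma bounded_linear_cscale_left: "bounded_linear (\<lambda>t. t *\<^sub>c (v :: 'a :: complex_normed_space))"
proof (rule bounded_linear_intro[where K = "norm v"])
  show "(r *\<^sub>R t) *\<^sub>c v = r *\<^sub>R (t *\<^sub>c v)" for r t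
    by (metis cscale_cscale cscale_of_real scaleR_conv_of_real)
qed (auto simp: cscale_add_left norm_cscale)

definition holo_at :: "('v :: complex_normed_space \<Rightarrow> complex) \<Rightarrow> 'v \<Rightarrow> bool" where
  "holo_at f x \<longleftrightarrow> (\<exists>D. (f has_derivative D) (at x) \<and> (\<forall>c v. D (c *\<^sub>c v) = c * D v))"

(* Meromorphic: locally a quotient g / h of holomorphic functions with h not identically zero.
   Only the values off the zero set of h are constrained; functions agreeing on a dense open
   set are identified in the quotient type mero below. *)
definition meromorphic_fun :: "('v :: complex_normed_space \<Rightarrow> complex) \<Rightarrow> bool" where
  "meromorphic_fun f \<longleftrightarrow> (\<forall>x. \<exists>U g h. open U \<and> connected U \<and> x \<in> U \<and>
     (\<forall>y\<in>U. holo_at g y \<and> holo_at h y) \<and> (\<exists>y\<in>U. h y \<noteq> 0) \<and>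
     (\<forall>y\<in>U. h y \<noteq> 0 \<longrightarrow> f y = g y / h y))"

definition agree :: "('v :: topological_space \<Rightarrow> 'b) \<Rightarrow> ('v \<Rightarrow> 'b) \<Rightarrow> bool" where
  "agree f g \<longleftrightarrow> closure (interior {x. f x = g x}) = UNIV"

lemma holo_at_const [simp]: "holo_at (\<lambda>_. c) x"
  unfolding holo_at_def by (rule exI[of _ "\<lambda>_. 0"]) auto

lemma holo_at_add: "holo_at f x \<Longrightarrow> holo_at g x \<Longrightarrow> holo_at (\<lambda>x. f x + g x) x"
  unfolding holo_at_def
  by (elim exE conjE, rule exI[where x="\<lambda>v. _ v + _ v"]) (auto intro!: derivative_eq_intros simp: algebra_simps)

lemma holo_at_mult: "holo_at f x \<Longrightarrow> holo_at g x \<Longrightarrow> holo_at (\<lambda>x. f x * g x) x"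
  unfolding holo_at_def
  by (elim exE conjE, rule exI, rule conjI, rule has_derivative_mult) (auto simp: algebra_simps)

lemma holo_at_isCont: "holo_at f x \<Longrightarrow> isCont f x"
  unfolding holo_at_def using has_derivative_continuous by blast

lemma holo_line:
  assumes "holo_at f (x + t *\<^sub>c v)"
  shows "(\<lambda>t. f (x + t *\<^sub>c v)) field_differentiable (at t)"
proof -
  obtain D where D: "(f has_derivative D) (at (x + t *\<^sub>c v))" "\<And>c v. D (c *\<^sub>c v) = c * D v"
    using assms unfolding holo_at_def by blast
  have "((\<lambda>t. x + t *\<^sub>c v) has_derivative (\<lambda>t. t *\<^sub>c v)) (at t)"
    by (auto intro!: derivative_eq_intros bounded_linear.has_derivative[OF bounded_linear_cscale_left])
  from has_derivative_compose[OF this D(1)]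
  have "((\<lambda>t. f (x + t *\<^sub>c v)) has_derivative (\<lambda>t. D (t *\<^sub>c v))) (at t)" .
  thus ?thesis unfolding D(2) field_differentiable_def has_field_derivative_def
    by (metis (no_types, lifting) ext mult.commute)
qed

lemma holo_ball_zero:
  assumes "\<forall>y\<in>ball x r. holo_at f y" "open W" "W \<noteq> {}" "W \<subseteq> ball x r" "\<forall>y\<in>W. f y = 0" "y \<in> ball x r"
  shows "f y = 0"
proof -
  obtain w where w: "w \<in> W" using assms by blast
  define v where "v = y - w"
  define T where "T = (\<lambda>t. w + t *\<^sub>c v) -` ball x r"
  define T' where "T' = (\<lambda>t. w + t *\<^sub>c v) -` W"
  have cont: "continuous_on UNIV (\<lambda>t. w + t *\<^sub>c v)"
    by (intro continuous_intros linear_continuous_on bounded_linear_cscale_left)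
  have op: "open T" "open T'"
    unfolding T_def T'_def using cont assms(2) by (auto intro!: open_vimage)
  have "convex T"
  proof (rule convexI)
    fix s t :: complex and a b :: real assume st: "s \<in> T" "t \<in> T" "0 \<le> a" "0 \<le> b" "a + b = 1"
    have "w + (a *\<^sub>R s + b *\<^sub>R t) *\<^sub>c v = a *\<^sub>R (w + s *\<^sub>c v) + b *\<^sub>R (w + t *\<^sub>c v)"
    proof -
      have "(a *\<^sub>R s + b *\<^sub>R t) *\<^sub>c v = a *\<^sub>R (s *\<^sub>c v) + b *\<^sub>R (t *\<^sub>c v)"
        unfolding cscale_add_left scaleR_conv_of_real cscale_cscale[symmetric] cscale_of_real ..
      moreover have "w = a *\<^sub>R w + b *\<^sub>R w" by (simp only: st(5) scaleR_one flip: scaleR_add_left)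
      ultimately have "w + (a *\<^sub>R s + b *\<^sub>R t) *\<^sub>c v
          = (a *\<^sub>R w + b *\<^sub>R w) + (a *\<^sub>R (s *\<^sub>c v) + b *\<^sub>R (t *\<^sub>c v))" by (rule arg_cong2[where f="(+)", rotated])
      thus ?thesis by (simp only: scaleR_add_right add_ac)
    qed
    moreover have "\<dots> \<in> ball x r"
      by (rule convexD[OF convex_ball]) (use st in \<open>auto simp: T_def\<close>)
    ultimately show "a *\<^sub>R s + b *\<^sub>R t \<in> T" unfolding T_def by (metis vimageI)
  qed
  hence "connected T" by (rule convex_connected)
  have 0: "0 \<in> T'" using w by (simp add: T'_def)
  have "f (w + 1 *\<^sub>c v) = 0"
  proof (rule analytic_continuation[where f="\<lambda>t. f (w + t *\<^sub>c v)" and S=T and U=T' and \<xi>=0 and w=1])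
    show "(\<lambda>t. f (w + t *\<^sub>c v)) holomorphic_on T"
      unfolding holomorphic_on_def
      by (intro ballI, rule field_differentiable_at_within, rule holo_line)
        (use assms in \<open>auto simp: T_def\<close>)
    show "0 islimpt T'" using 0 op(2)
      by (simp add: interior_limit_point interior_open)
    show "1 \<in> T" using assms(6) cscale_of_real[of 1 v] by (simp add: T_def v_def)
  qed (use op \<open>connected T\<close> assms 0 in \<open>auto simp: T_def T'_def\<close>)
  thus ?thesis using cscale_of_real[of 1 v] by (simp add: v_def)
qed

lemma holo_open_zero:
  assumes "open U" "connected U" "\<forall>y\<in>U. holo_at f y" "open W" "W \<noteq> {}" "W \<subseteq> U" "\<forall>y\<in>W. f y = 0"
  shows "\<forall>y\<in>U. f y = 0"
proof -
  define Z where "Z = interior {y\<in>U. f y = 0}"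
  have Zo: "open Z" by (simp add: Z_def)
  have ZU: "Z \<subseteq> U" using interior_subset by (auto simp: Z_def)
  have key: "x \<in> Z" if "x \<in> U" "x \<in> closure Z" for x
  proof -
    obtain r where r: "r > 0" "ball x r \<subseteq> U" using openE[OF assms(1) \<open>x \<in> U\<close>] by blast
    have ne: "Z \<inter> ball x r \<noteq> {}" 
      using that(2) r(1) unfolding closure_approachable by (metis IntI dist_commute empty_iff mem_ball)
    have "f y = 0" if "y \<in> ball x r" for y
      by (rule holo_ball_zero[of x r f "Z \<inter> ball x r"])
         (use r assms(3) ne Zo that interior_subset in \<open>auto simp: Z_def\<close>)
    hence "ball x r \<subseteq> {y\<in>U. f y = 0}" using r by auto
    thus "x \<in> Z" unfolding Z_def using r(1) by (meson centre_in_ball interior_maximal open_ball subsetD)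
  qed
  have "Z \<inter> U = {} \<or> (U - Z) \<inter> U = {}"
  proof (rule ccontr)
    assume *: "\<not> ?thesis"
    have "U - Z = U \<inter> (- closure Z)" using key closure_subset by blast
    hence "open (U - Z)" using assms(1) by (auto intro!: open_Int)
    moreover have "Z \<noteq> {}" "U - Z \<noteq> {}" using * by auto
    ultimately show False using assms(2) Zo ZU unfolding connected_def by blast
  qed
  moreover have "W \<subseteq> Z" unfolding Z_def by (rule interior_maximal) (use assms in auto)
  ultimately have "U \<subseteq> Z" using assms(5) ZU by blast
  thus ?thesis using interior_subset unfolding Z_def by blast
qed

lemma dense_Int:
  assumes "closure (interior S) = UNIV" "closure (interior T) = (UNIV :: 'a :: topological_space set)"
  shows "closure (interior (S \<inter> T)) = UNIV"
proof -
  have "interior S \<subseteq> closure (interior S \<inter> interior T)"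
    using open_Int_closure_subset[of "interior S" "interior T"] assms by simp
  hence "closure (interior S) \<subseteq> closure (interior S \<inter> interior T)"
    using closure_minimal by blast
  thus ?thesis using assms by (simp add: interior_Int top.extremum_unique)
qed

lemma agree_refl [simp]: "agree f f" by (simp add: agree_def)
lemma agree_sym: "agree f g \<Longrightarrow> agree g f" unfolding agree_def by (simp add: eq_commute)

lemma agree_mono2:
  assumes "agree f g" "agree f' g'" "\<And>x. f x = g x \<Longrightarrow> f' x = g' x \<Longrightarrow> F x = G x"
  shows "agree F G"
proof -
  have "{x. f x = g x} \<inter> {x. f' x = g' x} \<subseteq> {x. F x = G x}" using assms(3) by auto
  from closure_mono[OF interior_mono[OF this]] show ?thesis
    using dense_Int assms(1,2) unfolding agree_def by (metis top.extremum_uniqueI)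
qed

lemma agree_trans: "agree f g \<Longrightarrow> agree g h \<Longrightarrow> agree f h"
  by (erule agree_mono2) auto

lemma meromorphic_funI:
  assumes "\<And>x. \<exists>U g h. open U \<and> connected U \<and> x \<in> U \<and>
     (\<forall>y\<in>U. holo_at g y \<and> holo_at h y) \<and> (\<exists>y\<in>U. h y \<noteq> 0) \<and>
     (\<forall>y\<in>U. h y \<noteq> 0 \<longrightarrow> f y = g y / h y)"
  shows "meromorphic_fun f"
  using assms by (simp add: meromorphic_fun_def)

lemma meromorphic_funE:
  assumes "meromorphic_fun f" "open W" "x \<in> W"
  obtains r g h where "r > 0" "ball x r \<subseteq> W" "\<forall>y\<in>ball x r. holo_at g y \<and> holo_at h y"
    "\<And>V. open V \<Longrightarrow> V \<noteq> {} \<Longrightarrow> V \<subseteq> ball x r \<Longrightarrow> \<exists>y\<in>V. h y \<noteq> 0"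
    "\<forall>y\<in>ball x r. h y \<noteq> 0 \<longrightarrow> f y = g y / h y"
proof -
  obtain U g h where U: "open U" "connected U" "x \<in> U"
    "\<forall>y\<in>U. holo_at g y \<and> holo_at h y" "\<exists>y\<in>U. h y \<noteq> 0" "\<forall>y\<in>U. h y \<noteq> 0 \<longrightarrow> f y = g y / h y"
    using assms(1)[unfolded meromorphic_fun_def, rule_format, of x] by blast
  have "open (U \<inter> W)" "x \<in> U \<inter> W" using U assms by auto
  then obtain r where r: "r > 0" "ball x r \<subseteq> U \<inter> W" using openE by blast
  show thesis
  proof (rule that[of r g h])
    show "\<exists>y\<in>V. h y \<noteq> 0" if "open V" "V \<noteq> {}" "V \<subseteq> ball x r" for V
      using holo_open_zero[OF U(1,2), of h V] U(4,5) that r by blast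
  qed (use r U in auto)
qed

lemma holo_nonzero_open:
  assumes "open V" "\<forall>y\<in>V. holo_at h y"
  shows "open {y\<in>V. h y \<noteq> 0}"
proof -
  have "continuous_on V h"
    using assms holo_at_isCont by (intro continuous_at_imp_continuous_on) blast
  moreover have "{y\<in>V. h y \<noteq> 0} = h -` (-{0}) \<inter> V" by auto
  ultimately show ?thesis
    by (metis assms(1) continuous_on_open_vimage open_Compl closed_singleton)
qed

lemma mero_const: "meromorphic_fun (\<lambda>_. c)"
  by (rule meromorphic_funI, rule exI[of _ UNIV], rule exI[of _ "\<lambda>_. c"], rule exI[of _ "\<lambda>_. 1"]) auto

lemma mero_holo: "(\<And>x. holo_at f x) \<Longrightarrow> meromorphic_fun f"
  by (rule meromorphic_funI, rule exI[of _ UNIV], rule exI[of _ f], rule exI[of _ "\<lambda>_. 1"]) auto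

lemma mero_op2:
  fixes f g :: "'v::complex_normed_space \<Rightarrow> complex"
  assumes f: "meromorphic_fun f" and g: "meromorphic_fun g"
    and F: "\<And>a b c d (x::'v). holo_at a x \<Longrightarrow> holo_at b x \<Longrightarrow> holo_at c x \<Longrightarrow> holo_at d x \<Longrightarrow>
         holo_at (\<lambda>x. N (a x) (b x) (c x) (d x)) x"
    and eq: "\<And>a b c d. b \<noteq> 0 \<Longrightarrow> d \<noteq> 0 \<Longrightarrow> P (a / b) (c / d) = N a b c d / (b * d)"
  shows "meromorphic_fun (\<lambda>x. P (f x) (g x))"
proof (rule meromorphic_funI)
  fix x :: 'v
  obtain r a b where 1: "r > 0" "ball x r \<subseteq> UNIV" "\<forall>y\<in>ball x r. holo_at a y \<and> holo_at b y"
    "\<And>V. open V \<Longrightarrow> V \<noteq> {} \<Longrightarrow> V \<subseteq> ball x r \<Longrightarrow> \<exists>y\<in>V. b y \<noteq> 0"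
    "\<forall>y\<in>ball x r. b y \<noteq> 0 \<longrightarrow> f y = a y / b y"
    using meromorphic_funE[OF f open_UNIV UNIV_I[of x]] by metis
  have xr: "x \<in> ball x r" using 1 by simp
  obtain s c d where 2: "s > 0" "ball x s \<subseteq> ball x r" "\<forall>y\<in>ball x s. holo_at c y \<and> holo_at d y"
    "\<And>V. open V \<Longrightarrow> V \<noteq> {} \<Longrightarrow> V \<subseteq> ball x s \<Longrightarrow> \<exists>y\<in>V. d y \<noteq> 0"
    "\<forall>y\<in>ball x s. d y \<noteq> 0 \<longrightarrow> g y = c y / d y"
    using meromorphic_funE[OF g open_ball xr] by metis
  have "\<exists>y\<in>ball x s. d y \<noteq> 0" using 2(1) 2(4)[of "ball x s"] by auto
  moreover have "open {y\<in>ball x s. d y \<noteq> 0}" using holo_nonzero_open[of "ball x s" d] 2 by simp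
  ultimately obtain y where y: "y \<in> ball x s" "d y \<noteq> 0" "b y \<noteq> 0"
    using 1(4)[of "{y\<in>ball x s. d y \<noteq> 0}"] 2(2) by blast
  show "\<exists>U g' h'. open U \<and> connected U \<and> x \<in> U \<and>
     (\<forall>y\<in>U. holo_at g' y \<and> holo_at h' y) \<and> (\<exists>y\<in>U. h' y \<noteq> 0) \<and>
     (\<forall>y\<in>U. h' y \<noteq> 0 \<longrightarrow> P (f y) (g y) = g' y / h' y)"
    apply (rule exI[of _ "ball x s"], rule exI[of _ "\<lambda>x. N (a x) (b x) (c x) (d x)"],
           rule exI[of _ "\<lambda>x. b x * d x"])
    using 1 2 y by (auto intro!: F holo_at_mult bexI[of _ y] simp: eq subset_iff)
qed

lemma mero_add: "meromorphic_fun f \<Longrightarrow> meromorphic_fun g \<Longrightarrow> meromorphic_fun (\<lambda>x. f x + g x)"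
  by (rule mero_op2[where N = "\<lambda>a b c d. a * d + c * b" and P = "(+)"])
     (auto intro!: holo_at_add holo_at_mult simp: field_simps)

lemma mero_mult: "meromorphic_fun f \<Longrightarrow> meromorphic_fun g \<Longrightarrow> meromorphic_fun (\<lambda>x. f x * g x)"
  by (rule mero_op2[where N = "\<lambda>a b c d. a * c" and P = "(*)"]) (auto intro!: holo_at_mult)

lemma mero_uminus: "meromorphic_fun f \<Longrightarrow> meromorphic_fun (\<lambda>x. - f x)"
  using mero_mult[OF mero_const[of "-1"], of f] by simp

lemma mero_diff: "meromorphic_fun f \<Longrightarrow> meromorphic_fun g \<Longrightarrow> meromorphic_fun (\<lambda>x. f x - g x)"
  using mero_add[OF _ mero_uminus, of f g] by simp

lemma mero_inverse:
  assumes "meromorphic_fun f" shows "meromorphic_fun (\<lambda>x. inverse (f x))"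
proof (rule meromorphic_funI)
  fix x
  obtain r a b where 1: "r > 0" "ball x r \<subseteq> UNIV" "\<forall>y\<in>ball x r. holo_at a y \<and> holo_at b y"
    "\<And>V. open V \<Longrightarrow> V \<noteq> {} \<Longrightarrow> V \<subseteq> ball x r \<Longrightarrow> \<exists>y\<in>V. b y \<noteq> 0"
    "\<forall>y\<in>ball x r. b y \<noteq> 0 \<longrightarrow> f y = a y / b y"
    using meromorphic_funE[OF assms open_UNIV UNIV_I[of x]] by metis
  have bo: "\<exists>y\<in>ball x r. b y \<noteq> 0" using 1(1) 1(4)[of "ball x r"] by auto
  show "\<exists>U g h. open U \<and> connected U \<and> x \<in> U \<and>
     (\<forall>y\<in>U. holo_at g y \<and> holo_at h y) \<and> (\<exists>y\<in>U. h y \<noteq> 0) \<and>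
     (\<forall>y\<in>U. h y \<noteq> 0 \<longrightarrow> inverse (f y) = g y / h y)"
  proof (cases "\<forall>y\<in>ball x r. a y = 0")
    case True
    thus ?thesis using 1 bo
      by (intro exI[of _ "ball x r"] exI[of _ "\<lambda>_. 0"] exI[of _ b]) auto
  next
    case False
    have "open {y\<in>ball x r. a y \<noteq> 0}" using holo_nonzero_open[of "ball x r" a] 1 by simp
    moreover have "{y\<in>ball x r. a y \<noteq> 0} \<noteq> {}" "{y\<in>ball x r. a y \<noteq> 0} \<subseteq> ball x r"
      using False by auto
    ultimately obtain y where y: "y \<in> ball x r" "a y \<noteq> 0" "b y \<noteq> 0"
      using 1(4)[of "{y\<in>ball x r. a y \<noteq> 0}"] by blast
    show ?thesis using 1 y
      by (intro exI[of _ "ball x r"] exI[of _ "\<lambda>y. b y * b y"] exI[of _ "\<lambda>y. a y * b y"])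
         (auto intro!: holo_at_mult bexI[of _ y])
  qed
qed

lemma mero_zero_or_nonzero:
  assumes "meromorphic_fun f" "\<not> agree f (\<lambda>_. 0)"
  shows "closure (interior {x. f x \<noteq> 0}) = UNIV"
proof -
  define A where "A = interior (closure (interior {x. f x = 0}))"
  define B where "B = interior (closure (interior {x. f x \<noteq> 0}))"
  have cover: "x \<in> A \<union> B" for x
  proof -
    obtain r a b where 1: "r > 0" "ball x r \<subseteq> UNIV" "\<forall>y\<in>ball x r. holo_at a y \<and> holo_at b y"
      "\<And>V. open V \<Longrightarrow> V \<noteq> {} \<Longrightarrow> V \<subseteq> ball x r \<Longrightarrow> \<exists>y\<in>V. b y \<noteq> 0"
      "\<forall>y\<in>ball x r. b y \<noteq> 0 \<longrightarrow> f y = a y / b y"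
      using meromorphic_funE[OF assms(1) open_UNIV UNIV_I[of x]] by metis
    have sub: "ball x r \<subseteq> closure S" if "\<And>V. open V \<Longrightarrow> V \<noteq> {} \<Longrightarrow> V \<subseteq> ball x r \<Longrightarrow> V \<inter> S \<noteq> {}" for S
    proof (rule ccontr)
      assume "\<not> ball x r \<subseteq> closure S"
      hence "ball x r \<inter> - closure S \<noteq> {}" by blast
      moreover have "open (ball x r \<inter> - closure S)" by (intro open_Int open_Compl) auto
      ultimately have "(ball x r \<inter> - closure S) \<inter> S \<noteq> {}" using that by blast
      thus False using closure_subset by blast
    qed
    have ob: "open {y\<in>ball x r. b y \<noteq> 0}" using holo_nonzero_open[of "ball x r" b] 1 by simp
    have oa: "open {y\<in>ball x r. a y \<noteq> 0}" using holo_nonzero_open[of "ball x r" a] 1 by simp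
    show ?thesis
    proof (cases "\<forall>y\<in>ball x r. a y = 0")
      case True
      have "{y\<in>ball x r. b y \<noteq> 0} \<subseteq> interior {x. f x = 0}"
        by (rule interior_maximal[OF _ ob]) (use 1 True in auto)
      hence "ball x r \<subseteq> closure (interior {x. f x = 0})"
        using 1(4) by (intro sub) blast
      hence "ball x r \<subseteq> A" unfolding A_def by (simp add: interior_maximal)
      thus ?thesis using 1(1) centre_in_ball by blast
    next
      case False
      have op: "open ({y\<in>ball x r. a y \<noteq> 0} \<inter> {y\<in>ball x r. b y \<noteq> 0})" using oa ob by blast
      have "{y\<in>ball x r. a y \<noteq> 0} \<inter> {y\<in>ball x r. b y \<noteq> 0} \<subseteq> interior {x. f x \<noteq> 0}"
        by (rule interior_maximal[OF _ op]) (use 1 in auto)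
      moreover have "V \<inter> ({y\<in>ball x r. a y \<noteq> 0} \<inter> {y\<in>ball x r. b y \<noteq> 0}) \<noteq> {}"
        if V: "open V" "V \<noteq> {}" "V \<subseteq> ball x r" for V
      proof -
        have "\<exists>y\<in>V. a y \<noteq> 0"
          using holo_ball_zero[of x r a V] V 1(3) False by blast
        hence "V \<inter> {y\<in>ball x r. a y \<noteq> 0} \<noteq> {}" using V(3) by blast
        moreover have "open (V \<inter> {y\<in>ball x r. a y \<noteq> 0})" using V oa by blast
        ultimately have "\<exists>y\<in>V \<inter> {y\<in>ball x r. a y \<noteq> 0}. b y \<noteq> 0" by (intro 1(4)) auto
        thus ?thesis by auto
      qed
      ultimately have "ball x r \<subseteq> closure (interior {x. f x \<noteq> 0})"
        by (intro sub) blast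
      hence "ball x r \<subseteq> B" unfolding B_def by (simp add: interior_maximal)
      thus ?thesis using 1(1) centre_in_ball by blast
    qed
  qed
  have disj: "A \<inter> B = {}"
  proof (rule ccontr)
    assume ne: "A \<inter> B \<noteq> {}"
    have o: "open (A \<inter> B)" by (auto simp: A_def B_def)
    have "A \<inter> B \<subseteq> closure (interior {x. f x = 0})" unfolding A_def using interior_subset by blast
    hence "(A \<inter> B) \<inter> interior {x. f x = 0} \<noteq> {}"
      using ne o by (metis Int_absorb2 open_Int_closure_eq_empty)
    moreover have "open ((A \<inter> B) \<inter> interior {x. f x = 0})" using o by blast
    moreover have "(A \<inter> B) \<inter> interior {x. f x = 0} \<subseteq> closure (interior {x. f x \<noteq> 0})"
      unfolding B_def using interior_subset by blast
    ultimately have "(A \<inter> B) \<inter> interior {x. f x = 0} \<inter> interior {x. f x \<noteq> 0} \<noteq> {}"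
      by (metis Int_absorb2 open_Int_closure_eq_empty)
    thus False using interior_subset by blast
  qed
  have "A = {} \<or> B = {}"
    using connected_UNIV[where 'a='a] cover disj unfolding connected_def A_def B_def
    by (metis Int_UNIV_right open_interior subsetI sup_inf_absorb)
  moreover have "A \<noteq> UNIV"
  proof
    assume "A = UNIV"
    hence "closure (interior {x. f x = 0}) = UNIV" unfolding A_def using interior_subset by blast
    thus False using assms(2) by (simp add: agree_def)
  qed
  ultimately have "B = UNIV" using cover by blast
  thus ?thesis unfolding B_def using interior_subset by blast
qed

definition meqv :: "('v :: complex_normed_space \<Rightarrow> complex) \<Rightarrow> ('v \<Rightarrow> complex) \<Rightarrow> bool" where
  "meqv f g \<longleftrightarrow> meromorphic_fun f \<and> meromorphic_fun g \<and> agree f g"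

(* The field of meromorphic functions on the complex vector space 'v. *)
quotient_type (overloaded) 'v mero = "'v :: complex_normed_space \<Rightarrow> complex" / partial: meqv
proof (rule part_equivpI)
  show "\<exists>x. meqv x x" using mero_const by (auto simp: meqv_def)
  show "symp meqv" by (auto simp: symp_def meqv_def agree_sym)
  show "transp meqv" by (auto simp: transp_def meqv_def dest: agree_trans)
qed

instantiation mero :: (complex_normed_space) field
begin

lift_definition zero_mero :: "'a mero" is "\<lambda>_. 0" by (simp add: meqv_def mero_const)
lift_definition one_mero :: "'a mero" is "\<lambda>_. 1" by (simp add: meqv_def mero_const)
lift_definition plus_mero :: "'a mero \<Rightarrow> 'a mero \<Rightarrow> 'a mero" is "\<lambda>f g x. f x + g x"
  unfolding meqv_def by (auto intro: mero_add elim: agree_mono2)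
lift_definition minus_mero :: "'a mero \<Rightarrow> 'a mero \<Rightarrow> 'a mero" is "\<lambda>f g x. f x - g x"
  unfolding meqv_def by (auto intro: mero_diff elim: agree_mono2)
lift_definition times_mero :: "'a mero \<Rightarrow> 'a mero \<Rightarrow> 'a mero" is "\<lambda>f g x. f x * g x"
  unfolding meqv_def by (auto intro: mero_mult elim: agree_mono2)
lift_definition uminus_mero :: "'a mero \<Rightarrow> 'a mero" is "\<lambda>f x. - f x"
  unfolding meqv_def by (auto intro: mero_uminus elim: agree_mono2[OF _ agree_refl])
lift_definition inverse_mero :: "'a mero \<Rightarrow> 'a mero" is "\<lambda>f x. inverse (f x)"
  unfolding meqv_def by (auto intro: mero_inverse elim: agree_mono2[OF _ agree_refl])
definition divide_mero :: "'a mero \<Rightarrow> 'a mero \<Rightarrow> 'a mero" where "divide_mero f g = f * inverse g"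

lemma meqvI: "meromorphic_fun f \<Longrightarrow> f = g \<Longrightarrow> meqv f g" by (simp add: meqv_def)

instance
proof
  fix a b c :: "'a mero"
  show "a + b + c = a + (b + c)" by transfer (auto simp: meqv_def add.assoc intro!: mero_add)
  show "a + b = b + a" by transfer (auto simp: meqv_def add.commute intro!: mero_add)
  show "0 + a = a" by transfer (auto simp: meqv_def)
  show "- a + a = 0" by transfer (auto simp: meqv_def mero_const)
  show "a - b = a + - b" by transfer (auto simp: meqv_def intro!: mero_diff)
  show "a * b * c = a * (b * c)" by transfer (auto simp: meqv_def mult.assoc intro!: mero_mult)
  show "a * b = b * a" by transfer (auto simp: meqv_def mult.commute intro!: mero_mult)
  show "1 * a = a" by transfer (auto simp: meqv_def)
  show "(a + b) * c = a * c + b * c"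
    by transfer (auto simp: meqv_def distrib_right intro!: mero_add mero_mult)
  show "(0 :: 'a mero) \<noteq> 1" by transfer (auto simp: meqv_def agree_def)
  show "inverse 0 = (0 :: 'a mero)" by transfer (auto simp: meqv_def mero_const)
  show "a div b = a * inverse b" by (simp add: divide_mero_def)
  show "inverse a * a = 1" if "a \<noteq> 0"
    using that
  proof transfer
    fix f :: "'a \<Rightarrow> complex" assume f: "meqv f f" "\<not> meqv f (\<lambda>_. 0)"
    hence "closure (interior {x. f x \<noteq> 0}) = UNIV"
      by (intro mero_zero_or_nonzero) (auto simp: meqv_def mero_const)
    moreover have "{x. f x \<noteq> 0} \<subseteq> {x. inverse (f x) * f x = 1}" by auto
    ultimately have "agree (\<lambda>x. inverse (f x) * f x) (\<lambda>_. 1)"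
      unfolding agree_def by (metis closure_mono interior_mono top.extremum_uniqueI)
    thus "meqv (\<lambda>x. inverse (f x) * f x) (\<lambda>_. 1)"
      using f by (auto simp: meqv_def mero_const intro!: mero_mult mero_inverse)
  qed
qed

end

lift_definition mconst :: "complex \<Rightarrow> 'v :: complex_normed_space mero" is "\<lambda>c _. c"
  by (simp add: meqv_def mero_const)

lemma mconst_simps: "mconst 0 = 0" "mconst 1 = 1" "mconst (a + b) = mconst a + mconst b"
   "mconst (a * b) = mconst a * mconst b"
  by (transfer; simp add: meqv_def mero_const)+

lemma mconst_inj: "mconst a = mconst b \<longleftrightarrow> a = b"
  by transfer (auto simp: meqv_def mero_const agree_def)

lemma of_nat_mero: "of_nat n = mconst (of_nat n)"
  by (induction n) (simp_all add: mconst_simps)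

instance mero :: (complex_normed_space) field_char_0
  by standard (auto simp: inj_on_def of_nat_mero mconst_inj)



definition affine_surj :: "('w :: complex_normed_space \<Rightarrow> 'v :: complex_normed_space) \<Rightarrow> bool" where
  "affine_surj \<phi> \<longleftrightarrow> (\<exists>L \<psi> v. bounded_linear L \<and> (\<forall>c x. L (c *\<^sub>c x) = c *\<^sub>c L x) \<and>
     bounded_linear \<psi> \<and> (\<forall>w. L (\<psi> w) = w) \<and> (\<forall>x. \<phi> x = L x + v))"

lemma holo_at_comp:
  assumes "holo_at f (\<phi> x)" "affine_surj \<phi>" shows "holo_at (\<lambda>x. f (\<phi> x)) x"
proof -
  obtain L v where L: "bounded_linear L" "\<And>c x. L (c *\<^sub>c x) = c *\<^sub>c L x" "\<And>x. \<phi> x = L x + v"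
    using assms(2) unfolding affine_surj_def by blast
  obtain D where D: "(f has_derivative D) (at (\<phi> x))" "\<And>c v. D (c *\<^sub>c v) = c * D v"
    using assms(1) unfolding holo_at_def by blast
  have "(\<phi> has_derivative L) (at x)"
    unfolding L(3) by (auto intro!: derivative_eq_intros bounded_linear_imp_has_derivative L)
  from has_derivative_compose[OF this D(1)] show ?thesis
    unfolding holo_at_def using D(2) L(2) by (intro exI[of _ "\<lambda>x. D (L x)"]) auto
qed

lemma affine_surj_cont: "affine_surj \<phi> \<Longrightarrow> continuous_on UNIV \<phi>"
  unfolding affine_surj_def
  by (elim exE conjE, simp, intro continuous_on_add continuous_on_const linear_continuous_on)

lemma affine_surj_open:
  assumes "affine_surj \<phi>" "open U" shows "open (\<phi> ` U)"
proof -
  obtain L \<psi> v where L: "bounded_linear L" "bounded_linear \<psi>" "\<And>w. L (\<psi> w) = w" "\<And>x. \<phi> x = L x + v"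
    using assms(1) unfolding affine_surj_def by metis
  show ?thesis
  proof (subst open_subopen, intro ballI)
    fix y assume "y \<in> \<phi> ` U"
    then obtain x where x: "x \<in> U" "y = \<phi> x" by blast
    define k where "k = (\<lambda>w. x + \<psi> (w - y))"
    have "continuous_on UNIV k" unfolding k_def
      by (intro continuous_intros linear_continuous_on_compose continuous_on_compose2[OF linear_continuous_on[OF L(2), of UNIV]]) auto
    hence "open (k -` U)" using assms(2) by (rule open_vimage[rotated])
    moreover have "y \<in> k -` U" using x bounded_linear.linear[OF L(2)] by (simp add: k_def linear_0)
    moreover have "k -` U \<subseteq> \<phi> ` U"
    proof
      fix w assume "w \<in> k -` U"
      moreover have "\<phi> (k w) = w"
        using bounded_linear.linear[OF L(1)] bounded_linear.linear[OF L(2)] L(3)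
        by (simp add: L(4) k_def linear_add linear_diff x(2))
      ultimately show "w \<in> \<phi> ` U" by (metis imageI vimageD)
    qed
    ultimately show "\<exists>T. open T \<and> y \<in> T \<and> T \<subseteq> \<phi> ` U" by blast
  qed
qed

lemma mero_comp:
  assumes "meromorphic_fun f" "affine_surj \<phi>" shows "meromorphic_fun (\<lambda>x. f (\<phi> x))"
proof (rule meromorphic_funI)
  fix x
  obtain r a b where 1: "r > 0" "ball (\<phi> x) r \<subseteq> UNIV" "\<forall>y\<in>ball (\<phi> x) r. holo_at a y \<and> holo_at b y"
    "\<And>V. open V \<Longrightarrow> V \<noteq> {} \<Longrightarrow> V \<subseteq> ball (\<phi> x) r \<Longrightarrow> \<exists>y\<in>V. b y \<noteq> 0"
    "\<forall>y\<in>ball (\<phi> x) r. b y \<noteq> 0 \<longrightarrow> f y = a y / b y"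
    using meromorphic_funE[OF assms(1) open_UNIV UNIV_I[of "\<phi> x"]] by metis
  have "open (\<phi> -` ball (\<phi> x) r)" using affine_surj_cont[OF assms(2)] by (intro open_vimage) auto
  moreover have "x \<in> \<phi> -` ball (\<phi> x) r" using 1 by auto
  ultimately obtain s where s: "s > 0" "ball x s \<subseteq> \<phi> -` ball (\<phi> x) r" using openE by blast
  have "\<phi> ` ball x s \<noteq> {}" "\<phi> ` ball x s \<subseteq> ball (\<phi> x) r" using s by auto
  from 1(4)[OF affine_surj_open[OF assms(2) open_ball] this]
  obtain y where y: "y \<in> ball x s" "b (\<phi> y) \<noteq> 0" by blast
  show "\<exists>U g h. open U \<and> connected U \<and> x \<in> U \<and>
     (\<forall>y\<in>U. holo_at g y \<and> holo_at h y) \<and> (\<exists>y\<in>U. h y \<noteq> 0) \<and>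
     (\<forall>y\<in>U. h y \<noteq> 0 \<longrightarrow> f (\<phi> y) = g y / h y)"
    apply (rule exI[of _ "ball x s"], rule exI[of _ "\<lambda>x. a (\<phi> x)"], rule exI[of _ "\<lambda>x. b (\<phi> x)"])
    using 1 s y by (auto intro!: holo_at_comp[OF _ assms(2)] bexI[of _ y] simp: subset_iff)
qed

lemma agree_comp:
  assumes "agree f g" "affine_surj \<phi>" shows "agree (\<lambda>x. f (\<phi> x)) (\<lambda>x. g (\<phi> x))"
proof -
  define S where "S = interior {x. f x = g x}"
  have S: "open S" "closure S = UNIV" using assms(1) by (auto simp: S_def agree_def)
  have op: "open (\<phi> -` S)" using affine_surj_cont[OF assms(2)] S by (intro open_vimage) auto
  have "\<phi> -` S \<subseteq> {x. f (\<phi> x) = g (\<phi> x)}" using interior_subset by (auto simp: S_def)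
  hence sub: "\<phi> -` S \<subseteq> interior {x. f (\<phi> x) = g (\<phi> x)}" using op by (rule interior_maximal)
  have "V \<inter> \<phi> -` S \<noteq> {}" if "open V" "V \<noteq> {}" for V
  proof -
    have "open (\<phi> ` V)" "\<phi> ` V \<noteq> {}" using affine_surj_open[OF assms(2)] that by auto
    hence "\<phi> ` V \<inter> S \<noteq> {}" using S(2) by (metis Int_UNIV_right open_Int_closure_eq_empty)
    thus ?thesis by blast
  qed
  from this[of "- closure (\<phi> -` S)"] have "closure (\<phi> -` S) = UNIV"
    using closure_subset[of "\<phi> -` S"] by blast
  thus ?thesis using closure_mono[OF sub] unfolding agree_def by (metis top.extremum_uniqueI)
qed

(* Precomposition f o phi; only used for surjective affine maps phi (projections, translations). *)
lift_definition mcomp :: "('w \<Rightarrow> 'v) \<Rightarrow> 'v :: complex_normed_space mero \<Rightarrow> 'w :: complex_normed_space mero"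
  is "\<lambda>\<phi> f. if affine_surj \<phi> then (\<lambda>x. f (\<phi> x)) else (\<lambda>_. 0)"
  by (auto simp: meqv_def mero_const intro: mero_comp agree_comp)

lemma affine_surj_comp:
  assumes "affine_surj \<phi>" "affine_surj \<phi>'" shows "affine_surj (\<lambda>x. \<phi> (\<phi>' x))"
proof -
  obtain L \<psi> v where 1: "bounded_linear L" "\<And>c x. L (c *\<^sub>c x) = c *\<^sub>c L x" "bounded_linear \<psi>"
    "\<And>w. L (\<psi> w) = w" "\<And>x. \<phi> x = L x + v"
    using assms(1) unfolding affine_surj_def by metis
  obtain L' \<psi>' v' where 2: "bounded_linear L'" "\<And>c x. L' (c *\<^sub>c x) = c *\<^sub>c L' x" "bounded_linear \<psi>'"
    "\<And>w. L' (\<psi>' w) = w" "\<And>x. \<phi>' x = L' x + v'"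
    using assms(2) unfolding affine_surj_def by metis
  have "\<phi> (\<phi>' x) = L (L' x) + (L v' + v)" for x
    by (simp add: 1(5) 2(5) linear_add[OF bounded_linear.linear[OF 1(1)]] add.assoc)
  moreover note bounded_linear_compose[OF 1(1) 2(1)] bounded_linear_compose[OF 2(3) 1(3)]
  ultimately show ?thesis
    unfolding affine_surj_def
    by (intro exI[of _ "\<lambda>x. L (L' x)"] exI[of _ "\<lambda>x. \<psi>' (\<psi> x)"] exI[of _ "L v' + v"])
       (simp add: 1(2,4) 2(2,4))
qed

lemma mcomp_mcomp:
  assumes "affine_surj \<phi>" "affine_surj \<phi>'"
  shows "mcomp \<phi>' (mcomp \<phi> f) = mcomp (\<lambda>x. \<phi> (\<phi>' x)) f"
  using assms affine_surj_comp[OF assms]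
  by transfer (auto simp: meqv_def intro: mero_comp[of _ "\<lambda>x. _ (_ x)"])

lemma affine_surj_shift: "affine_surj (\<lambda>x. x + v)"
  unfolding affine_surj_def by (intro exI[of _ "\<lambda>x. x"] exI[of _ v]) auto

lemma affine_surj_fst: "affine_surj (fst :: 'a :: complex_normed_space \<times> 'b :: complex_normed_space \<Rightarrow> 'a)"
  unfolding affine_surj_def
  by (intro exI[of _ fst] exI[of _ "\<lambda>x. (x, 0)"] exI[of _ 0])
     (auto simp: cscale_prod_def bounded_linear_fst intro!: bounded_linear_Pair)

lemma affine_surj_snd: "affine_surj (snd :: 'a :: complex_normed_space \<times> 'b :: complex_normed_space \<Rightarrow> 'b)"
  unfolding affine_surj_def
  by (intro exI[of _ snd] exI[of _ "\<lambda>x. (0, x)"] exI[of _ 0])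
     (auto simp: cscale_prod_def bounded_linear_snd intro!: bounded_linear_Pair)

(* The dual Cartan space of dimension N - 1, as the sum-zero vectors of C^N, N = CARD('n).
   Being self-dual under the form it also serves as the range of the dynamical variables:
   a value of s = (s_(ebar j))_j is a point s of this space, with s_beta = (s, beta). *)
typedef 'n wt = "{x :: complex ^ 'n::finite. (\<Sum>j\<in>UNIV. x $ j) = 0}"
  morphisms wt_vec Abs_wt
  by (rule exI[of _ 0]) simp

setup_lifting type_definition_wt

instantiation wt :: (finite) complex_normed_space
begin
lift_definition zero_wt :: "'a wt" is 0 by simp
lift_definition plus_wt :: "'a wt \<Rightarrow> 'a wt \<Rightarrow> 'a wt" is "(+)" by (simp add: sum.distrib)
lift_definition minus_wt :: "'a wt \<Rightarrow> 'a wt \<Rightarrow> 'a wt" is "(-)" by (simp add: sum_subtractf)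
lift_definition uminus_wt :: "'a wt \<Rightarrow> 'a wt" is uminus by (simp add: sum_negf)
lift_definition scaleR_wt :: "real \<Rightarrow> 'a wt \<Rightarrow> 'a wt" is "(*\<^sub>R)"
  by (simp flip: scaleR_sum_right)
lift_definition cscale_wt :: "complex \<Rightarrow> 'a wt \<Rightarrow> 'a wt" is "(*s)"
  by (simp flip: sum_distrib_left)
lift_definition norm_wt :: "'a wt \<Rightarrow> real" is norm .
definition dist_wt :: "'a wt \<Rightarrow> 'a wt \<Rightarrow> real" where "dist_wt x y = norm (x - y)"
definition sgn_wt :: "'a wt \<Rightarrow> 'a wt" where "sgn_wt x = inverse (norm x) *\<^sub>R x"
definition uniformity_wt :: "('a wt \<times> 'a wt) filter" where
  "uniformity_wt = (INF e\<in>{0<..}. principal {(x, y). dist x y < e})"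
definition open_wt :: "'a wt set \<Rightarrow> bool" where
  "open_wt U \<longleftrightarrow> (\<forall>x\<in>U. \<forall>\<^sub>F (x', y) in uniformity. x' = x \<longrightarrow> y \<in> U)"
instance
proof
  fix x y z :: "'a wt" and a b :: complex and r s :: real
  show "x + y + z = x + (y + z)" by transfer simp
  show "x + y = y + x" by transfer simp
  show "0 + x = x" by transfer simp
  show "- x + x = 0" by transfer simp
  show "x - y = x + - y" by transfer simp
  show "r *\<^sub>R (x + y) = r *\<^sub>R x + r *\<^sub>R y" by transfer (simp add: scaleR_add_right)
  show "(r + s) *\<^sub>R x = r *\<^sub>R x + s *\<^sub>R x" by transfer (simp add: scaleR_add_left)
  show "r *\<^sub>R s *\<^sub>R x = (r * s) *\<^sub>R x" by transfer simp
  show "1 *\<^sub>R x = x" by transfer simp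
  show "norm x = 0 \<longleftrightarrow> x = 0" by transfer simp
  show "norm (x + y) \<le> norm x + norm y" by transfer (rule norm_triangle_ineq)
  show "norm (r *\<^sub>R x) = \<bar>r\<bar> * norm x" by transfer simp
  show "a *\<^sub>c (x + y) = a *\<^sub>c x + a *\<^sub>c y" by transfer (simp add: vec_eq_iff algebra_simps)
  show "(a + b) *\<^sub>c x = a *\<^sub>c x + b *\<^sub>c x" by transfer (simp add: vec_eq_iff algebra_simps)
  show "a *\<^sub>c b *\<^sub>c x = (a * b) *\<^sub>c x" by transfer (simp add: vec_eq_iff algebra_simps)
  show "of_real r *\<^sub>c x = r *\<^sub>R x" by transfer (simp add: vec_eq_iff scaleR_conv_of_real[where 'a=complex])
  show "norm (a *\<^sub>c x) = norm a * norm x"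
    by transfer (simp add: norm_vec_def norm_mult L2_set_right_distrib)
qed (simp_all add: dist_wt_def sgn_wt_def uniformity_wt_def open_wt_def)
end

lift_definition wform :: "'n::finite wt \<Rightarrow> 'n wt \<Rightarrow> complex"
  is "\<lambda>x y. \<Sum>j\<in>UNIV. x $ j * y $ j" .

lift_definition ebar :: "'n::finite \<Rightarrow> 'n wt"
  is "\<lambda>j. axis j 1 - (\<chi> k. 1 / of_nat CARD('n))"
  by (simp add: sum_subtractf axis_def)

lemma wform_ebar_ebar:
  "wform (ebar j) (ebar k :: 'n::finite wt) = (if j = k then 1 else 0) - 1 / of_nat CARD('n)"
proof -
  have "(\<Sum>i\<in>UNIV. (axis j 1 - (\<chi> k. 1 / of_nat CARD('n))) $ i *
            (axis k 1 - (\<chi> k. 1 / of_nat CARD('n))) $ i)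
      = (\<Sum>i\<in>UNIV. (if i = j then if i = k then 1 else 0 else 0) 
           - (if i = j then 1 / of_nat CARD('n) else 0) - (if i = k then 1 / of_nat CARD('n) else 0)
           + (1 / of_nat CARD('n)) * (1 / of_nat CARD('n :: finite)) :: complex)"
    by (intro sum.cong) (auto simp: axis_def algebra_simps)
  also have "\<dots> = (if j = k then 1 else 0) - 1 / of_nat CARD('n)"
    by (simp add: sum.distrib sum_subtractf)
  finally show ?thesis by transfer simp
qed

lemma bounded_linear_wform: "bounded_linear (\<lambda>x. wform x y)"
proof (rule bounded_linear_intro[where K = "norm y * real CARD('a::finite)"])
  fix x z :: "'a wt" and r :: real
  show "wform (x + z) y = wform x y + wform z y"
    by transfer (simp add: algebra_simps sum.distrib)
  show "wform (r *\<^sub>R x) y = r *\<^sub>R wform x y"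
    by transfer (simp add: scaleR_sum_right)
  show "norm (wform x y) \<le> norm x * (norm y * real CARD('a))"
  proof transfer
    fix x y :: "complex ^ 'a"
    have "norm (\<Sum>j\<in>UNIV. x $ j * y $ j) \<le> (\<Sum>j\<in>(UNIV :: 'a set). norm x * norm y)"
      by (rule sum_norm_le) (subst norm_mult, intro mult_mono, simp_all add: Finite_Cartesian_Product.norm_nth_le)
    thus "norm (\<Sum>j\<in>UNIV. x $ j * y $ j) \<le> norm x * (norm y * real CARD('a))"
      by (simp add: mult.commute mult.left_commute)
  qed
qed

lemma wform_cscale: "wform (c *\<^sub>c x) y = c * wform x y"
  by transfer (simp add: sum_distrib_left mult.assoc)

(* The coordinate function s_beta, linear in beta. *)
lift_definition dynvar :: "'n::finite wt \<Rightarrow> 'n wt mero" is "\<lambda>\<beta> s. wform s \<beta>"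
proof -
  fix \<beta> :: "'n wt"
  have "holo_at (\<lambda>s. wform s \<beta>) x" for x
    unfolding holo_at_def
    by (intro exI[of _ "\<lambda>s. wform s \<beta>"] conjI bounded_linear_imp_has_derivative bounded_linear_wform)
       (simp add: wform_cscale)
  thus "meqv (\<lambda>s. wform s \<beta>) (\<lambda>s. wform s \<beta>)" by (simp add: meqv_def mero_holo)
qed

(* Both H^* and H are triples: (mu, nu, k) in H^* is mu + Q_nu + k Lambda_0, and
   (beta, gamma, l) in H is h_beta + P_gamma + l c. *)
type_synonym 'n hw = "'n wt \<times> 'n wt \<times> complex"

definition pairing :: "'n::finite hw \<Rightarrow> 'n hw \<Rightarrow> complex" where
  "pairing = (\<lambda>(\<mu>, \<nu>, k) (\<beta>, \<gamma>, l). wform \<mu> \<beta> + wform \<nu> \<gamma> + k * l)"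

definition P_plus_h :: "'n::finite wt \<Rightarrow> 'n hw" where "P_plus_h \<beta> = (\<beta>, \<beta>, 0)"
definition P_dyn :: "'n::finite wt \<Rightarrow> 'n hw" where "P_dyn \<beta> = (0, \<beta>, 0)"
definition Q_dyn :: "'n::finite wt \<Rightarrow> 'n hw" where "Q_dyn \<alpha> = (0, \<alpha>, 0)"

(* The values taken by P+h and by P at a point of H^*, see pairing_P_plus_h, pairing_P_dyn. *)
definition pt_Ph :: "'n::finite hw \<Rightarrow> 'n wt" where "pt_Ph = (\<lambda>(\<mu>, \<nu>, k). \<mu> + \<nu>)"
definition pt_P :: "'n::finite hw \<Rightarrow> 'n wt" where "pt_P = (\<lambda>(\<mu>, \<nu>, k). \<nu>)"

lemma wform_add_left: "wform (x + y) z = wform x z + wform y z"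
  by transfer (simp add: algebra_simps sum.distrib)

lemma wform_zero [simp]: "wform 0 x = 0" "wform x 0 = 0"
  by (transfer; simp)+

lemma pairing_P_plus_h: "pairing \<xi> (P_plus_h \<beta>) = wform (pt_Ph \<xi>) \<beta>"
  by (cases \<xi>) (simp add: pairing_def P_plus_h_def pt_Ph_def wform_add_left)

lemma pairing_P_dyn: "pairing \<xi> (P_dyn \<beta>) = wform (pt_P \<xi>) \<beta>"
  by (cases \<xi>) (simp add: pairing_def P_dyn_def pt_P_def)

lemma bounded_linear_fst_snd: "bounded_linear (\<lambda>x. fst (snd x))"
  by (rule bounded_linear_compose[OF bounded_linear_fst bounded_linear_snd])

lemma affine_surj_pt_Ph: "affine_surj (pt_Ph :: 'n::finite hw \<Rightarrow> 'n wt)"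
proof -
  have eq: "(pt_Ph :: 'n hw \<Rightarrow> 'n wt) = (\<lambda>x. fst x + fst (snd x))"
    by (simp add: pt_Ph_def case_prod_unfold fun_eq_iff)
  have "bounded_linear (pt_Ph :: 'n hw \<Rightarrow> 'n wt)"
    unfolding eq by (intro bounded_linear_add bounded_linear_fst bounded_linear_fst_snd)
  moreover have "bounded_linear (\<lambda>x :: 'n wt. (x, 0 :: 'n wt, 0 :: complex))"
    by (intro bounded_linear_Pair bounded_linear_ident bounded_linear_zero)
  moreover have "pt_Ph (c *\<^sub>c x) = c *\<^sub>c pt_Ph x" for c and x :: "'n hw"
    by (simp add: eq cscale_prod_def cscale_add_right)
  moreover have "pt_Ph (x :: 'n wt, 0 :: 'n wt, 0 :: complex) = x" for x
    by (simp add: eq)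
  ultimately show ?thesis
    unfolding affine_surj_def
    by (intro exI[of _ pt_Ph] exI[of _ "\<lambda>x. (x, 0, 0)"] exI[of _ 0]) simp
qed

lemma affine_surj_pt_P: "affine_surj (pt_P :: 'n::finite hw \<Rightarrow> 'n wt)"
proof -
  have eq: "(pt_P :: 'n hw \<Rightarrow> 'n wt) = (\<lambda>x. fst (snd x))"
    by (simp add: pt_P_def case_prod_unfold fun_eq_iff)
  have "bounded_linear (pt_P :: 'n hw \<Rightarrow> 'n wt)"
    unfolding eq by (rule bounded_linear_fst_snd)
  moreover have "bounded_linear (\<lambda>x :: 'n wt. (0 :: 'n wt, x, 0 :: complex))"
    by (intro bounded_linear_Pair bounded_linear_ident bounded_linear_zero)
  moreover have "pt_P (c *\<^sub>c x) = c *\<^sub>c pt_P x" for c and x :: "'n hw"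
    by (simp add: eq cscale_prod_def)
  moreover have "pt_P (0 :: 'n wt, x :: 'n wt, 0 :: complex) = x" for x
    by (simp add: eq)
  ultimately show ?thesis
    unfolding affine_surj_def
    by (intro exI[of _ pt_P] exI[of _ "\<lambda>x. (0, x, 0)"] exI[of _ 0]) simp
qed

(* If fhat = f(P+h), as a function on H^*, then T_alpha fhat = (f shifted by pt_Ph alpha)(P+h);
   similarly for P. *)
lemma translate_hat:
  "mcomp (\<lambda>\<xi>. \<xi> + \<alpha>) (mcomp pt_Ph f) = mcomp pt_Ph (mcomp (\<lambda>s. s + pt_Ph \<alpha>) f)"
  "mcomp (\<lambda>\<xi>. \<xi> + \<alpha>) (mcomp pt_P f) = mcomp pt_P (mcomp (\<lambda>s. s + pt_P \<alpha>) f)"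
proof -
  have "pt_Ph (\<xi> + \<alpha>) = pt_Ph \<xi> + pt_Ph \<alpha>" "pt_P (\<xi> + \<alpha>) = pt_P \<xi> + pt_P \<alpha>" for \<xi>
    by (simp_all add: pt_Ph_def pt_P_def case_prod_unfold)
  thus "mcomp (\<lambda>\<xi>. \<xi> + \<alpha>) (mcomp pt_Ph f) = mcomp pt_Ph (mcomp (\<lambda>s. s + pt_Ph \<alpha>) f)"
    and "mcomp (\<lambda>\<xi>. \<xi> + \<alpha>) (mcomp pt_P f) = mcomp pt_P (mcomp (\<lambda>s. s + pt_P \<alpha>) f)"
    by (simp_all add: mcomp_mcomp affine_surj_shift affine_surj_pt_Ph affine_surj_pt_P)
qed

lemma pairing_Q: "pairing (Q_dyn \<alpha>) (P_plus_h \<beta>) = wform \<alpha> \<beta>" "pairing (Q_dyn \<alpha>) (P_dyn \<beta>) = wform \<alpha> \<beta>"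
  by (simp_all add: pairing_def P_plus_h_def P_dyn_def Q_dyn_def)


(* M1: functions f(s) of one set of dynamical variables; FF: functions f(P+h, P), the first
   argument being P+h.  The outer fls adjoins the indeterminate hbar to the ground field:
   coefficients are meromorphic functions over C((hbar)), where q = e^hbar makes sense. *)
type_synonym 'n M1 = "'n wt mero fls"
type_synonym 'n FF = "('n wt \<times> 'n wt) mero fls"

definition fls_map :: "('a::zero \<Rightarrow> 'b::zero) \<Rightarrow> 'a fls \<Rightarrow> 'b fls" where
  "fls_map \<phi> f = Abs_fls (\<lambda>n. \<phi> (fls_nth f n))"
definition fps_map :: "('a \<Rightarrow> 'b) \<Rightarrow> 'a fps \<Rightarrow> 'b fps" where
  "fps_map \<phi> f = Abs_fps (\<lambda>n. \<phi> (fps_nth f n))"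

lemma fls_map_nth: "\<phi> 0 = 0 \<Longrightarrow> fls_nth (fls_map \<phi> f) n = \<phi> (fls_nth f n)"
  unfolding fls_map_def
  by (subst nth_Abs_fls_lower_bound[where N = "fls_subdegree f"]) auto

definition at_Ph :: "'n::finite M1 \<Rightarrow> 'n FF" where "at_Ph = fls_map (mcomp fst)"
definition at_P :: "'n::finite M1 \<Rightarrow> 'n FF" where "at_P = fls_map (mcomp snd)"
definition shift :: "'n::finite wt \<Rightarrow> 'n M1 \<Rightarrow> 'n M1" where "shift v = fls_map (mcomp (\<lambda>s. s + v))"

(* q^x = e^(hbar x) *)
definition qpow :: "'v::complex_normed_space mero \<Rightarrow> 'v mero fls" where
  "qpow x = fps_to_fls (fps_exp x)"

(* In power series over a field the variable fps_X is the nome p, and infinite products and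
   sums are p-adic.  poch_p X is (X; p)_infinity. *)
definition poch_p :: "'a::field fps \<Rightarrow> 'a fps" where
  "poch_p X = prodinf (\<lambda>m. 1 - X * fps_X ^ m)"
definition theta_p :: "'a::field \<Rightarrow> 'a fps" where
  "theta_p x = poch_p (fps_const x) * poch_p (fps_X * fps_const (inverse x)) * poch_p fps_X"

(* For formal q the product (x; Q)_infinity = prod_n (1 - x Q^n) is given by its expansion in x
   (Euler), whose coefficients are rational in Q.  By the functional equation below it is the
   series f with f(0) = 1 and f(x) = (1 - x) f(Q x). *)
definition euler_coeff :: "'a::field \<Rightarrow> nat \<Rightarrow> 'a" where
  "euler_coeff Q k = (-1) ^ k * Q ^ (k * (k - 1) div 2) / (\<Prod>i=1..k. 1 - Q ^ i)"

lemma euler_functional_equation: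
  assumes "\<And>i. i > 0 \<Longrightarrow> Q ^ i \<noteq> (1 :: 'a :: field)"
  shows "Abs_fps (euler_coeff Q) = (1 - fps_X) * Abs_fps (\<lambda>k. euler_coeff Q k * Q ^ k)"
proof (rule fps_ext)
  fix n
  show "fps_nth (Abs_fps (euler_coeff Q)) n =
        fps_nth ((1 - fps_X) * Abs_fps (\<lambda>k. euler_coeff Q k * Q ^ k)) n"
  proof (cases n)
    case 0 thus ?thesis by (simp add: euler_coeff_def fps_mult_nth)
  next
    case (Suc k)
    have "(\<Prod>i=1..k. 1 - Q ^ i) \<noteq> 0" using assms by (auto simp: eq_commute[of 1])
    moreover have "1 - Q ^ Suc k \<noteq> 0" using assms[of "Suc k"] by (metis right_minus_eq zero_less_Suc)
    moreover have "Suc k * (Suc k - 1) div 2 = k * (k - 1) div 2 + k"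
      by (cases k) (auto simp: algebra_simps)
    moreover have "(\<Prod>i=1..Suc k. 1 - Q ^ i) = (1 - Q ^ Suc k) * (\<Prod>i=1..k. 1 - Q ^ i)"
      by (simp add: prod.nat_ivl_Suc' del: power_Suc)
    ultimately have "euler_coeff Q (Suc k) * (1 - Q ^ Suc k) = - (euler_coeff Q k * Q ^ k)"
      unfolding euler_coeff_def by (simp add: power_add del: prod.cl_ivl_Suc)
    hence "euler_coeff Q (Suc k) = euler_coeff Q (Suc k) * Q ^ Suc k - euler_coeff Q k * Q ^ k"
      by (simp add: algebra_simps)
    thus ?thesis by (simp add: Suc left_diff_distrib)
  qed
qed

(* The variable z is fls_X, so coefficients in K((z)) realise the expansion of p-independent
   factors in nonnegative powers of z.  poch_Q_z Q a is (a z; Q)_infinity, expanded in z;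
   poch_Q Q X is (X; Q)_infinity for X divisible by p, expanded p-adically. *)
definition poch_Q_z :: "'a::field \<Rightarrow> 'a \<Rightarrow> 'a fls fps" where
  "poch_Q_z Q a = fps_const (fps_to_fls (Abs_fps (\<lambda>k. euler_coeff Q k * a ^ k)))"
definition poch_Q :: "'a::field \<Rightarrow> 'a fls fps \<Rightarrow> 'a fls fps" where
  "poch_Q Q X = suminf (\<lambda>k. fps_const (fls_const (euler_coeff Q k)) * X ^ k)"

(* With Q = q^(2N): brace_z Q a is {a z} and brace_pz Q a is {p a / z}; the product over the
   exponent of p is taken last. *)
definition brace_z :: "'a::field \<Rightarrow> 'a \<Rightarrow> 'a fls fps" where
  "brace_z Q a = poch_Q_z Q a *
     prodinf (\<lambda>m. poch_Q Q (fps_const (fls_const a * fls_X) * fps_X ^ Suc m))"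
definition brace_pz :: "'a::field \<Rightarrow> 'a \<Rightarrow> 'a fls fps" where
  "brace_pz Q a = prodinf (\<lambda>m. poch_Q Q (fps_const (fls_const a * fls_X_inv) * fps_X ^ Suc m))"

lemma fps_summable_onI:
  fixes f :: "'i \<Rightarrow> 'a :: ab_group_add fps"
  assumes "\<And>m. finite {r. fps_nth (f r) m \<noteq> 0}"
  shows "f summable_on UNIV"
proof -
  define S where "S = Abs_fps (\<lambda>m. \<Sum>r\<in>{r. fps_nth (f r) m \<noteq> 0}. fps_nth (f r) m)"
  have "(sum f \<longlongrightarrow> S) (finite_subsets_at_top UNIV)"
  proof (rule topological_tendstoI)
    fix U assume "open U" "S \<in> U"
    then obtain n where n: "{G. fps_cutoff n G = fps_cutoff n S} \<subseteq> U"
      unfolding open_fps_iff by blast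
    define F0 where "F0 = (\<Union>m<n. {r. fps_nth (f r) m \<noteq> 0})"
    have "sum f F \<in> U" if "finite F" "F0 \<subseteq> F" for F
    proof -
      have "fps_nth (sum f F) m = fps_nth S m" if "m < n" for m
        unfolding S_def fps_sum_nth fps_nth_Abs_fps
        by (rule sum.mono_neutral_right) (use \<open>finite F\<close> \<open>F0 \<subseteq> F\<close> that in \<open>auto simp: F0_def\<close>)
      hence "fps_cutoff n (sum f F) = fps_cutoff n S" by (simp add: fps_eq_iff)
      thus ?thesis using n by blast
    qed
    thus "\<forall>\<^sub>F F in finite_subsets_at_top UNIV. sum f F \<in> U"
      unfolding eventually_finite_subsets_at_top
      by (intro exI[of _ F0]) (use assms in \<open>auto simp: F0_def\<close>)
  qed
  thus ?thesis unfolding summable_on_def has_sum_def by blast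
qed

lemma fps_convergent_prodI:
  fixes g :: "nat \<Rightarrow> 'a :: field fps"
  assumes "\<And>m k. k < m \<Longrightarrow> fps_nth (g m) k = (if k = 0 then 1 else 0)"
  shows "convergent_prod g"
proof -
  define P where "P = (\<lambda>n. \<Prod>i\<le>n. g (i + 1))"
  have step: "fps_nth (P (Suc n)) k = fps_nth (P n) k" if "k \<le> n" for n k
  proof -
    have "fps_nth (P n * g (Suc n + 1)) k = (\<Sum>i\<le>k. fps_nth (P n) (k - i) * (if i = 0 then 1 else 0))"
      unfolding fps_mult_nth
      by (rule sum.reindex_bij_witness[of _ "\<lambda>i. k - i" "\<lambda>i. k - i"]) (use assms that in auto)
    also have "\<dots> = fps_nth (P n) k" by (simp add: if_distrib cong: if_cong)
    finally show ?thesis by (simp add: P_def)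
  qed
  have stab: "fps_nth (P n) k = fps_nth (P k) k" if "n \<ge> k" for n k
    using that by (induction n rule: dec_induct) (auto simp: step)
  have "P \<longlonglongrightarrow> Abs_fps (\<lambda>k. fps_nth (P k) k)"
    by (rule tendsto_fpsI) (auto intro: stab eventually_mono[OF eventually_ge_at_top])
  moreover have "fps_nth (P 0) 0 = 1" using assms[of 0 1] by (simp add: P_def)
  hence "Abs_fps (\<lambda>k. fps_nth (P k) k) \<noteq> 0" by (metis fps_nth_Abs_fps fps_zero_nth zero_neq_one)
  ultimately show ?thesis unfolding convergent_prod_def raw_has_prod_def P_def by blast
qed

lemma convergent_poch_p: "convergent_prod (\<lambda>m. 1 - X * fps_X ^ m :: 'a :: field fps)"
  by (rule fps_convergent_prodI) (simp add: fps_X_power_mult_right_nth)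

lemma poch_Q_summand_nth:
  fixes Y :: "'a :: field fls fps"
  assumes "t < k * Suc m"
  shows "fps_nth (fps_const c * (Y * fps_X ^ Suc m) ^ k) t = 0"
proof -
  have "fps_const c * (Y * fps_X ^ Suc m) ^ k = (fps_const c * Y ^ k) * fps_X ^ (k * Suc m)"
    by (simp only: power_mult_distrib power_mult[symmetric] mult.assoc mult.commute[of "Suc m"])
  thus ?thesis using assms by (simp only: fps_X_power_mult_right_nth if_True)
qed

lemma summable_poch_Q:
  fixes Y :: "'a :: field fls fps"
  shows "summable (\<lambda>k. fps_const (fls_const (euler_coeff Q k)) * (Y * fps_X ^ Suc m) ^ k)"
proof (rule summable_on_imp_summable, rule fps_summable_onI)
  fix t
  have "{k. fps_nth (fps_const (fls_const (euler_coeff Q k)) * (Y * fps_X ^ Suc m) ^ k) t \<noteq> 0} \<subseteq> {..t}"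
  proof safe
    fix k assume *: "fps_nth (fps_const (fls_const (euler_coeff Q k)) * (Y * fps_X ^ Suc m) ^ k) t \<noteq> 0"
    have "\<not> t < k * Suc m" using * poch_Q_summand_nth by blast
    thus "k \<le> t" by simp
  qed
  thus "finite {k. fps_nth (fps_const (fls_const (euler_coeff Q k)) * (Y * fps_X ^ Suc m) ^ k) t \<noteq> 0}"
    using finite_subset by blast
qed

lemma convergent_brace:
  fixes Y :: "'a :: field fls fps"
  shows "convergent_prod (\<lambda>m. poch_Q Q (Y * fps_X ^ Suc m))"
proof (rule fps_convergent_prodI)
  fix m t :: nat assume "t < m"
  let ?f = "\<lambda>k. fps_const (fls_const (euler_coeff Q k)) * (Y * fps_X ^ Suc m) ^ k"
  have "(\<lambda>n. \<Sum>k<n. ?f k) \<longlonglongrightarrow> poch_Q Q (Y * fps_X ^ Suc m)"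
    using summable_sums[OF summable_poch_Q] unfolding sums_def poch_Q_def .
  hence "\<forall>\<^sub>F n in sequentially. fps_nth (\<Sum>k<n. ?f k) t = fps_nth (poch_Q Q (Y * fps_X ^ Suc m)) t"
    unfolding tendsto_fps_iff by blast
  then obtain N where N: "\<And>n. n \<ge> N \<Longrightarrow>
      fps_nth (\<Sum>k<n. ?f k) t = fps_nth (poch_Q Q (Y * fps_X ^ Suc m)) t"
    unfolding eventually_sequentially by blast
  have "fps_nth (\<Sum>k<Suc N. ?f k) t = fps_nth (?f 0) t + (\<Sum>k<N. fps_nth (?f (Suc k)) t)"
    by (subst sum.lessThan_Suc_shift) (simp only: fps_add_nth fps_sum_nth)
  also have "(\<Sum>k<N. fps_nth (?f (Suc k)) t) = 0"
    using \<open>t < m\<close> by (intro sum.neutral ballI poch_Q_summand_nth) simp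
  also have "fps_nth (?f 0) t = (if t = 0 then 1 else 0)" by (simp add: euler_coeff_def)
  finally show "fps_nth (poch_Q Q (Y * fps_X ^ Suc m)) t = (if t = 0 then 1 else 0)"
    using N[of "Suc N"] by simp
qed

type_synonym 'n R_series = "'n M1 fls fps"

definition dynN :: "'n::finite itself \<Rightarrow> 'n wt mero" where "dynN _ = of_nat CARD('n)"

definition rho_plus :: "'n::finite R_series" where
  "rho_plus = (let N = dynN TYPE('n); Q = qpow (2 * N); br = brace_z Q; brp = brace_pz Q in
     fps_const (fls_const (qpow (- ((N - 1) / N)))) *
     ((br (qpow 2) * br (qpow (2 * N - 2)) * brp 1 * brp (qpow (2 * N))) /
      (br 1 * br (qpow (2 * N)) * brp (qpow 2) * brp (qpow (2 * N - 2)))))"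

definition cq :: "'n::finite wt mero \<Rightarrow> 'n M1 fls" where "cq x = fls_const (qpow x)"

definition R_b :: "'n::finite wt mero \<Rightarrow> 'n R_series" where
  "R_b s = fps_const (cq 1) * (theta_p (cq (2 * s + 2)) * theta_p (cq (2 * s - 2)) * theta_p fls_X) /
     (theta_p (cq (2 * s)) ^ 2 * theta_p (cq 2 * fls_X))"
definition R_bbar :: "'n::finite R_series" where
  "R_bbar = fps_const (cq 1) * theta_p fls_X / theta_p (cq 2 * fls_X)"
definition R_c :: "'n::finite wt mero \<Rightarrow> 'n R_series" where
  "R_c s = (theta_p (cq 2) * theta_p (cq (2 * s) * fls_X)) /
     (theta_p (cq (2 * s)) * theta_p (cq 2 * fls_X))"
definition R_cbar :: "'n::finite wt mero \<Rightarrow> 'n R_series" where "R_cbar s = R_c (- s)"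

definition dyn_diff :: "'n::finite \<Rightarrow> 'n \<Rightarrow> 'n wt mero" where
  "dyn_diff j l = dynvar (ebar j) - dynvar (ebar l)"

definition unit_entry :: "'n \<Rightarrow> 'n \<Rightarrow> 'n \<Rightarrow> 'n \<Rightarrow> 'a::zero_neq_one" where
  "unit_entry a b i j = (if i = a \<and> j = b then 1 else 0)"

(* The coefficient of E_ij (x) E_kl in R^+(z, s); unit_entry a b i j is the (i,j) entry of E_ab. *)
definition R_entry :: "'n::{finite,linorder} \<Rightarrow> 'n \<Rightarrow> 'n \<Rightarrow> 'n \<Rightarrow> 'n R_series" where
  "R_entry i j k l = rho_plus *
     ((\<Sum>a\<in>UNIV. unit_entry a a i j * unit_entry a a k l) +
      (\<Sum>a\<in>UNIV. \<Sum>b\<in>{a<..}.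
          R_b (dyn_diff a b) * unit_entry a a i j * unit_entry b b k l
        + R_bbar * unit_entry b b i j * unit_entry a a k l
        + R_c (dyn_diff a b) * unit_entry a b i j * unit_entry b a k l
        + R_cbar (dyn_diff a b) * unit_entry b a i j * unit_entry a b k l))"

definition z_coeff :: "int \<Rightarrow> 'a::zero fls fps \<Rightarrow> 'a fps" where
  "z_coeff r f = Abs_fps (\<lambda>m. fls_nth (fps_nth f m) r)"

(* Generators: the coefficient field, the modes of L, the derivation, q^(c/2) and q^(-c/2). *)
datatype 'n gen = Coef "('n::finite) FF" | Lgen 'n 'n int | Dgen | Cpos | Cneg

instantiation list :: (type) monoid_add
begin
definition zero_list :: "'a list" where "zero_list = []"
definition plus_list :: "'a list \<Rightarrow> 'a list \<Rightarrow> 'a list" where "plus_list = (@)"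
instance by standard (auto simp: zero_list_def plus_list_def)
end

(* The p-adic completion of Z<gen>[p]: the free associative ring on the generators (words are
   lists, multiplied by concatenation), power series in the central variable p. *)
type_synonym 'n free = "('n gen list \<Rightarrow>\<^sub>0 int) fps"

definition gen_elt :: "'n::finite gen \<Rightarrow> 'n free" where
  "gen_elt x = fps_const (Poly_Mapping.single [x] 1)"

(* emb f represents the sum of f_m p^m; emb_star f the sum of f_m pstar^m, pstar = p q^(-2c). *)
definition emb :: "'n::finite FF fps \<Rightarrow> 'n free" where
  "emb f = Abs_fps (\<lambda>m. Poly_Mapping.single [Coef (fps_nth f m)] 1)"

definition emb_star :: "'n::finite FF fps \<Rightarrow> 'n free" where
  "emb_star f = Abs_fps (\<lambda>m. Poly_Mapping.single [Coef (fps_nth f m)] 1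
      * Poly_Mapping.single [Cneg] 1 ^ (4 * m))"

(* The coefficient of z^(-n) in L^+_ij(z). *)
definition Lp :: "'n::finite \<Rightarrow> 'n \<Rightarrow> int \<Rightarrow> 'n free" where
  "Lp i j n = fps_X ^ nat (max n 0) * gen_elt (Lgen i j n)"

(* The coefficient of E_ij (x) E_kl z1^(-m) z2^(-n) on either side of the RLL relation.  The
   sums over r converge p-adically (RLL_summable). *)
definition RLL_lhs :: "'n::{finite,linorder} \<Rightarrow> 'n \<Rightarrow> 'n \<Rightarrow> 'n \<Rightarrow> int \<Rightarrow> int \<Rightarrow> 'n free" where
  "RLL_lhs i j k l m n = (\<Sum>\<^sub>\<infinity>r. \<Sum>a\<in>UNIV. \<Sum>b\<in>UNIV.
     emb (fps_map at_Ph (z_coeff r (R_entry i a k b))) * Lp a j (m + r) * Lp b l (n - r))"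

definition RLL_rhs :: "'n::{finite,linorder} \<Rightarrow> 'n \<Rightarrow> 'n \<Rightarrow> 'n \<Rightarrow> int \<Rightarrow> int \<Rightarrow> 'n free" where
  "RLL_rhs i j k l m n = (\<Sum>\<^sub>\<infinity>r. \<Sum>a\<in>UNIV. \<Sum>b\<in>UNIV.
     Lp k b (n - r) * Lp i a (m + r) * emb_star (fps_map at_P (z_coeff r (R_entry a j b l))))"

lemma Lp_nth_eq_0: "int k < n \<Longrightarrow> fps_nth (Lp i j n) k = 0"
  by (auto simp: Lp_def fps_X_power_mult_nth)

lemma Lp_Lp_low:
  assumes "int k < r \<or> int k < s"
  shows "fps_nth (F * Lp a b r * Lp c d s) k = 0" "fps_nth (Lp a b r * Lp c d s * F) k = 0"
proof -
  have "fps_nth (F * Lp a b r) l = 0" if "int l < r" for l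
    using that by (simp add: fps_mult_nth Lp_nth_eq_0)
  thus "fps_nth (F * Lp a b r * Lp c d s) k = 0"
    using assms by (auto simp: fps_mult_nth[of "F * Lp a b r"] Lp_nth_eq_0 intro!: sum.neutral)
  have "fps_nth (Lp a b r * Lp c d s) l = 0" if "int l < r \<or> int l < s" for l
    using that by (auto simp: fps_mult_nth Lp_nth_eq_0 intro!: sum.neutral)
  thus "fps_nth (Lp a b r * Lp c d s * F) k = 0"
    using assms by (auto simp: fps_mult_nth[of "Lp a b r * Lp c d s"] intro!: sum.neutral)
qed

lemma RLL_summable:
  "(\<lambda>r. \<Sum>a\<in>UNIV. \<Sum>b\<in>UNIV.
     emb (fps_map at_Ph (z_coeff r (R_entry i a k b))) * Lp a j (m + r) * Lp b l (n - r)) summable_on UNIV"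
  "(\<lambda>r. \<Sum>a\<in>UNIV. \<Sum>b\<in>UNIV.
     Lp k b (n - r) * Lp i a (m + r) * emb_star (fps_map at_P (z_coeff r (R_entry a j b l)))) summable_on UNIV"
proof -
  have *: "finite {r. fps_nth (\<Sum>a\<in>UNIV. \<Sum>b\<in>UNIV. f r a b) t \<noteq> 0}"
    if "\<And>r a b. int t < m + r \<or> int t < n - r \<Longrightarrow> fps_nth (f r a b) t = 0"
    for f :: "int \<Rightarrow> 'a \<Rightarrow> 'a \<Rightarrow> 'a free" and t
  proof (rule finite_subset)
    show "{r. fps_nth (\<Sum>a\<in>UNIV. \<Sum>b\<in>UNIV. f r a b) t \<noteq> 0} \<subseteq> {n - int t..int t - m}"
    proof safe
      fix r assume r: "fps_nth (\<Sum>a\<in>UNIV. \<Sum>b\<in>UNIV. f r a b) t \<noteq> 0"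
      have "\<not> (int t < m + r \<or> int t < n - r)"
        using r that[of r] by (auto simp: fps_sum_nth)
      thus "r \<in> {n - int t..int t - m}" by auto
    qed
  qed simp
  show "(\<lambda>r. \<Sum>a\<in>UNIV. \<Sum>b\<in>UNIV.
     emb (fps_map at_Ph (z_coeff r (R_entry i a k b))) * Lp a j (m + r) * Lp b l (n - r)) summable_on UNIV"
    by (rule fps_summable_onI, rule *) (auto intro!: Lp_Lp_low)
  show "(\<lambda>r. \<Sum>a\<in>UNIV. \<Sum>b\<in>UNIV.
     Lp k b (n - r) * Lp i a (m + r) * emb_star (fps_map at_P (z_coeff r (R_entry a j b l)))) summable_on UNIV"
    by (rule fps_summable_onI, rule *) (auto intro!: Lp_Lp_low)
qed

(* In order: the coefficient field embeds as a ring; q^(c/2), q^(-c/2) are central and mutually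
   inverse; exchange of g(P+h) and g(P) with L; the derivation commutes with the coefficients
   and [d, L^+(z)] = - z d/dz L^+(z), coefficientwise; RLL. *)
inductive_set ell_rels :: "'n::{finite,linorder} free set" where
  "gen_elt (Coef 1) - 1 \<in> ell_rels"
| "gen_elt (Coef (f + g)) - (gen_elt (Coef f) + gen_elt (Coef g)) \<in> ell_rels"
| "gen_elt (Coef (f * g)) - gen_elt (Coef f) * gen_elt (Coef g) \<in> ell_rels"
| "gen_elt Cpos * gen_elt x - gen_elt x * gen_elt Cpos \<in> ell_rels"
| "gen_elt Cneg * gen_elt x - gen_elt x * gen_elt Cneg \<in> ell_rels"
| "gen_elt Cpos * gen_elt Cneg - 1 \<in> ell_rels"
| "gen_elt (Coef (at_Ph g)) * gen_elt (Lgen i j n)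
     - gen_elt (Lgen i j n) * gen_elt (Coef (at_Ph (shift (- pt_Ph (Q_dyn (ebar i))) g))) \<in> ell_rels"
| "gen_elt (Coef (at_P g)) * gen_elt (Lgen i j n)
     - gen_elt (Lgen i j n) * gen_elt (Coef (at_P (shift (- pt_P (Q_dyn (ebar j))) g))) \<in> ell_rels"
| "gen_elt Dgen * gen_elt (Coef f) - gen_elt (Coef f) * gen_elt Dgen \<in> ell_rels"
| "(gen_elt Dgen * Lp i j n - Lp i j n * gen_elt Dgen) - of_int n * Lp i j n \<in> ell_rels"
| "RLL_lhs i j k l m n - RLL_rhs i j k l m n \<in> ell_rels"

definition two_sided_ideal :: "'a::ring_1 set \<Rightarrow> bool" where
  "two_sided_ideal I \<longleftrightarrow> 0 \<in> I \<and> (\<forall>x\<in>I. \<forall>y\<in>I. x + y \<in> I) \<and> (\<forall>x\<in>I. \<forall>a. a * x \<in> I \<and> x * a \<in> I)"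

definition ell_ideal :: "'n::{finite,linorder} free set" where
  "ell_ideal = \<Inter>{I. two_sided_ideal I \<and> closed I \<and> ell_rels \<subseteq> I}"

lemma two_sided_ideal_ell: "two_sided_ideal ell_ideal"
  unfolding ell_ideal_def two_sided_ideal_def by blast

definition ell_rel :: "'n::{finite,linorder} free \<Rightarrow> 'n free \<Rightarrow> bool" where
  "ell_rel x y \<longleftrightarrow> x - y \<in> ell_ideal"

lemma ell_ideal_simps:
  "0 \<in> ell_ideal" "x \<in> ell_ideal \<Longrightarrow> y \<in> ell_ideal \<Longrightarrow> x + y \<in> ell_ideal"
  "x \<in> ell_ideal \<Longrightarrow> a * x \<in> ell_ideal" "x \<in> ell_ideal \<Longrightarrow> x * a \<in> ell_ideal"
  "x \<in> ell_ideal \<Longrightarrow> - x \<in> ell_ideal"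
  using two_sided_ideal_ell mult_minus1[of x] unfolding two_sided_ideal_def by metis+

primrec gen_val :: "'n::finite gen \<Rightarrow> 'n FF" where
  "gen_val (Coef f) = f"
| "gen_val (Lgen i j n) = 0"
| "gen_val Dgen = 0"
| "gen_val Cpos = 1"
| "gen_val Cneg = 1"

definition word_val :: "'n::finite gen list \<Rightarrow> 'n FF" where
  "word_val w = prod_list (map gen_val w)"

definition pm_val :: "('n::finite gen list \<Rightarrow>\<^sub>0 int) \<Rightarrow> 'n FF" where
  "pm_val P = (\<Sum>w\<in>Poly_Mapping.keys P. of_int (Poly_Mapping.lookup P w) * word_val w)"

definition free_val :: "'n::finite free \<Rightarrow> 'n FF fps" where "free_val = fps_map pm_val"

lemma pm_val_superset:
  "finite A \<Longrightarrow> Poly_Mapping.keys P \<subseteq> A \<Longrightarrow>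
     pm_val P = (\<Sum>w\<in>A. of_int (Poly_Mapping.lookup P w) * word_val w)"
  unfolding pm_val_def
  by (rule sum.mono_neutral_left) (auto simp: in_keys_iff)

lemma pm_val_add: "pm_val (P + Q) = pm_val P + pm_val Q"
  using pm_val_superset[of "Poly_Mapping.keys P \<union> Poly_Mapping.keys Q" P]
    pm_val_superset[of "Poly_Mapping.keys P \<union> Poly_Mapping.keys Q" Q]
    pm_val_superset[of "Poly_Mapping.keys P \<union> Poly_Mapping.keys Q" "P + Q"]
    keys_add[of P Q]
  by (simp add: lookup_add sum.distrib algebra_simps)

lemma pm_val_0 [simp]: "pm_val 0 = 0" by (simp add: pm_val_def)

lemma pm_val_single: "pm_val (Poly_Mapping.single w c) = of_int c * word_val w"
  by (cases "c = 0") (simp_all add: pm_val_def)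

lemma pm_val_sum: "pm_val (sum f A) = (\<Sum>x\<in>A. pm_val (f x))"
  by (induction A rule: infinite_finite_induct) (simp_all add: pm_val_add)

lemma poly_mapping_sum_single:
  "P = (\<Sum>w\<in>Poly_Mapping.keys P. Poly_Mapping.single w (Poly_Mapping.lookup P w))"
  by (rule poly_mapping_eqI)
     (simp add: lookup_sum lookup_single when_def sum.delta in_keys_iff)

lemma pm_val_mult: "pm_val (P * Q) = pm_val P * pm_val Q"
proof -
  have "pm_val (P * Q) = pm_val ((\<Sum>w\<in>Poly_Mapping.keys P. Poly_Mapping.single w (Poly_Mapping.lookup P w))
      * (\<Sum>w\<in>Poly_Mapping.keys Q. Poly_Mapping.single w (Poly_Mapping.lookup Q w)))"
    using poly_mapping_sum_single[of P] poly_mapping_sum_single[of Q] by simp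
  also have "\<dots> = pm_val P * pm_val Q"
    unfolding sum_product pm_val_sum mult_single pm_val_single pm_val_def[of P] pm_val_def[of Q]
    by (intro sum.cong) (auto simp: plus_list_def word_val_def)
  finally show ?thesis .
qed

lemma pm_val_1 [simp]: "pm_val 1 = 1"
  by (simp add: pm_val_single word_val_def zero_list_def flip: single_one)

lemma pm_val_uminus: "pm_val (- P) = - pm_val P"
  using pm_val_add[of P "- P"] by (simp add: add_eq_0_iff)

lemma pm_val_power: "pm_val (P ^ n) = pm_val P ^ n"
  by (induction n) (simp_all add: pm_val_mult)

lemma free_val_add [simp]: "free_val (F + G) = free_val F + free_val G"
  by (simp add: free_val_def fps_map_def fps_eq_iff pm_val_add)

lemma free_val_uminus [simp]: "free_val (- F) = - free_val F"
  by (simp add: free_val_def fps_map_def fps_eq_iff pm_val_uminus)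

lemma free_val_diff [simp]: "free_val (F - G) = free_val F - free_val G"
  using free_val_add[of F "- G"] by simp

lemma free_val_0_1 [simp]: "free_val 0 = 0" "free_val 1 = 1"
  by (simp_all add: free_val_def fps_map_def fps_eq_iff fps_one_nth)

lemma free_val_mult [simp]: "free_val (F * G) = free_val F * free_val G"
  by (simp add: free_val_def fps_map_def fps_eq_iff fps_mult_nth pm_val_sum pm_val_mult)

lemma free_val_gen_elt [simp]: "free_val (gen_elt x) = fps_const (gen_val x)"
  by (simp add: free_val_def fps_map_def fps_eq_iff gen_elt_def pm_val_single word_val_def)

lemma free_val_emb [simp]: "free_val (emb f) = f"
  by (simp add: free_val_def fps_map_def fps_eq_iff emb_def pm_val_single word_val_def)

lemma free_val_emb_star [simp]: "free_val (emb_star f) = f"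
  by (simp add: free_val_def fps_map_def fps_eq_iff emb_star_def pm_val_single word_val_def
      pm_val_mult pm_val_power)

lemma free_val_Lp [simp]: "free_val (Lp i j n) = 0"
  by (simp add: Lp_def)

lemma free_val_sum: "free_val (sum f A) = (\<Sum>x\<in>A. free_val (f x))"
  by (induction A rule: infinite_finite_induct) simp_all

lemma closed_ker_free_val: "closed {F. free_val F = (0 :: 'n::finite FF fps)}"
proof -
  have "open (- {F. free_val F = (0 :: 'n FF fps)})"
    unfolding open_fps_iff
  proof
    fix F :: "'n free" assume "F \<in> - {F. free_val F = 0}"
    then obtain n where n: "pm_val (fps_nth F n) \<noteq> 0"
      by (auto simp: free_val_def fps_map_def fps_eq_iff)
    have "free_val G \<noteq> 0" if "fps_cutoff (Suc n) G = fps_cutoff (Suc n) F" for G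
    proof -
      have "fps_nth G n = fps_nth F n"
        using arg_cong[OF that, of "\<lambda>F. fps_nth F n"] by simp
      thus ?thesis using n by (auto simp: free_val_def fps_map_def fps_eq_iff intro!: exI[of _ n])
    qed
    thus "\<exists>n. {G. fps_cutoff n G = fps_cutoff n F} \<subseteq> - {F. free_val F = 0}"
      by (intro exI[of _ "Suc n"]) auto
  qed
  thus ?thesis by (simp add: closed_def)
qed

lemma infsum_in_closed:
  fixes f :: "'i \<Rightarrow> 'a :: {comm_monoid_add, t2_space}"
  assumes "closed S" "0 \<in> S" "\<And>x y. x \<in> S \<Longrightarrow> y \<in> S \<Longrightarrow> x + y \<in> S" "\<And>i. f i \<in> S"
  shows "infsum f A \<in> S"
proof (cases "f summable_on A")
  case True
  hence *: "(sum f \<longlongrightarrow> infsum f A) (finite_subsets_at_top A)"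
    using has_sum_infsum has_sum_def by metis
  have "sum f F \<in> S" for F
    by (induction F rule: infinite_finite_induct) (use assms in auto)
  thus ?thesis
    using Lim_in_closed_set[OF assms(1) _ _ *] by simp
qed (use assms in \<open>simp add: infsum_not_exists\<close>)

(* free_val is the character killing L and the derivation and sending q^(c/2) to 1; it shows that
   the relations do not collapse the algebra. *)
lemma free_val_RLL [simp]: "free_val (RLL_lhs i j k l m n) = 0" "free_val (RLL_rhs i j k l m n) = 0"
proof -
  have "RLL_lhs i j k l m n \<in> {F. free_val F = 0}" "RLL_rhs i j k l m n \<in> {F. free_val F = 0}"
    unfolding RLL_lhs_def RLL_rhs_def
    by (intro infsum_in_closed closed_ker_free_val; simp add: free_val_sum)+
  thus "free_val (RLL_lhs i j k l m n) = 0" "free_val (RLL_rhs i j k l m n) = 0" by auto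
qed

lemma free_val_ell_ideal:
  assumes "F \<in> ell_ideal" shows "free_val F = 0"
proof -
  have "two_sided_ideal {F. free_val F = (0 :: 'a FF fps)}" by (auto simp: two_sided_ideal_def)
  moreover have "free_val F = 0" if "F \<in> ell_rels" for F :: "'a free"
    using that by cases (simp_all add: mult.commute)
  ultimately show ?thesis
    using assms closed_ker_free_val unfolding ell_ideal_def by blast
qed

(* The elliptic algebra: the quotient by the closed two-sided ideal generated by the relations. *)
quotient_type (overloaded) 'n ell = "('n::{finite,linorder}) free" / ell_rel
proof (rule equivpI)
  show "reflp ell_rel" by (simp add: reflp_def ell_rel_def ell_ideal_simps)
  show "symp ell_rel" unfolding symp_def ell_rel_def by (metis ell_ideal_simps(5) minus_diff_eq)
  show "transp ell_rel"
  proof (rule transpI)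
    fix x y z assume "ell_rel x y" "ell_rel y z"
    hence "(x - y) + (y - z) \<in> ell_ideal" unfolding ell_rel_def by (rule ell_ideal_simps)
    thus "ell_rel x z" by (simp add: ell_rel_def)
  qed
qed

instantiation ell :: ("{finite,linorder}") ring_1
begin
lift_definition zero_ell :: "'a ell" is 0 .
lift_definition one_ell :: "'a ell" is 1 .
lift_definition plus_ell :: "'a ell \<Rightarrow> 'a ell \<Rightarrow> 'a ell" is "(+)"
proof -
  fix x y x' y' :: "'a free" assume "ell_rel x y" "ell_rel x' y'"
  hence "(x - y) + (x' - y') \<in> ell_ideal"
    unfolding ell_rel_def by (intro ell_ideal_simps)
  thus "ell_rel (x + x') (y + y')" unfolding ell_rel_def by (simp add: algebra_simps)
qed
lift_definition uminus_ell :: "'a ell \<Rightarrow> 'a ell" is uminus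
  unfolding ell_rel_def by (metis ell_ideal_simps(5) minus_diff_minus)
lift_definition minus_ell :: "'a ell \<Rightarrow> 'a ell \<Rightarrow> 'a ell" is "(-)"
proof -
  fix x y x' y' :: "'a free" assume "ell_rel x y" "ell_rel x' y'"
  hence "(x - y) + - (x' - y') \<in> ell_ideal"
    unfolding ell_rel_def by (intro ell_ideal_simps)
  thus "ell_rel (x - x') (y - y')" unfolding ell_rel_def by (simp add: algebra_simps)
qed
lift_definition times_ell :: "'a ell \<Rightarrow> 'a ell \<Rightarrow> 'a ell" is "(*)"
proof -
  fix x y x' y' :: "'a free" assume "ell_rel x y" "ell_rel x' y'"
  hence "(x - y) * x' + y * (x' - y') \<in> ell_ideal"
    unfolding ell_rel_def by (intro ell_ideal_simps)
  thus "ell_rel (x * x') (y * y')" unfolding ell_rel_def by (simp add: algebra_simps)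
qed
instance
proof
  show "(0 :: 'a ell) \<noteq> 1"
    by transfer (use free_val_ell_ideal in \<open>fastforce simp: ell_rel_def\<close>)
qed (transfer; simp add: ell_rel_def ell_ideal_simps algebra_simps)+
end


definition p_ell :: "'n::{finite,linorder} ell" where "p_ell = abs_ell fps_X"

instantiation ell :: ("{finite,linorder}") topological_space
begin
definition open_ell :: "'a ell set \<Rightarrow> bool" where
  "open_ell U \<longleftrightarrow> (\<forall>x\<in>U. \<exists>n. \<forall>y. x + p_ell ^ n * y \<in> U)"
instance
proof
  show "open (UNIV :: 'a ell set)" by (simp add: open_ell_def)
  show "open (\<Union>K)" if "\<forall>S\<in>K. open S" for K :: "'a ell set set"
    unfolding open_ell_def
  proof
    fix x assume "x \<in> \<Union>K"
    then obtain S where S: "S \<in> K" "x \<in> S" by blast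
    hence "\<exists>n. \<forall>y. x + p_ell ^ n * y \<in> S" using that unfolding open_ell_def by blast
    thus "\<exists>n. \<forall>y. x + p_ell ^ n * y \<in> \<Union>K" using S by blast
  qed
  show "open (S \<inter> T)" if ST: "open S" "open T" for S T :: "'a ell set"
    unfolding open_ell_def
  proof
    fix x assume "x \<in> S \<inter> T"
    then obtain m n where "\<And>y. x + p_ell ^ m * y \<in> S" "\<And>y. x + p_ell ^ n * y \<in> T"
      using ST unfolding open_ell_def by blast
    hence "x + p_ell ^ (m + n) * y \<in> S \<inter> T" for y
      by (metis IntI add.commute mult.assoc power_add)
    thus "\<exists>n. \<forall>y. x + p_ell ^ n * y \<in> S \<inter> T" by blast
  qed
qed
end

(* The structure map from power series in p over FF, and its variant with p replaced by pstar = p q^(-2c). *)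
definition ser :: "'n::{finite,linorder} FF fps \<Rightarrow> 'n ell" where "ser f = abs_ell (emb f)"
definition ser_star :: "'n::{finite,linorder} FF fps \<Rightarrow> 'n ell" where
  "ser_star f = abs_ell (emb_star f)"
definition Lbar :: "'n::{finite,linorder} \<Rightarrow> 'n \<Rightarrow> int \<Rightarrow> 'n ell" where
  "Lbar i j n = abs_ell (gen_elt (Lgen i j n))"

definition ground_const :: "complex fls \<Rightarrow> 'v::complex_normed_space mero fls" where
  "ground_const = fls_map mconst"
definition ell_const :: "complex fls \<Rightarrow> 'n::{finite,linorder} ell" where
  "ell_const c = ser (fps_const (ground_const c))"

definition mu_l :: "'n::{finite,linorder} M1 fps \<Rightarrow> 'n ell" where "mu_l f = ser (fps_map at_Ph f)"
definition mu_r :: "'n::{finite,linorder} M1 fps \<Rightarrow> 'n ell" where "mu_r f = ser_star (fps_map at_P f)"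

(* The linear combinations of the (P+h)_(ebar j) are the (P+h)_gamma, and likewise for P. *)
definition ell_comp :: "'n::{finite,linorder} hw \<Rightarrow> 'n hw \<Rightarrow> 'n ell set" where
  "ell_comp \<alpha> \<beta> = {a.
     (\<forall>\<gamma>. ser (fps_const (at_Ph (qpow (dynvar \<gamma>)))) * a * ser (fps_const (at_Ph (qpow (- dynvar \<gamma>))))
          = ser (fps_const (qpow (mconst (pairing \<alpha> (P_plus_h \<gamma>))))) * a) \<and>
     (\<forall>\<gamma>. ser (fps_const (at_P (qpow (dynvar \<gamma>)))) * a * ser (fps_const (at_P (qpow (- dynvar \<gamma>))))
          = ser (fps_const (qpow (mconst (pairing \<beta> (P_dyn \<gamma>))))) * a)}"

(* A first degree enters only through its restriction to the span of the (P+h)_(ebar j), a second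
   one only through its restriction to the span of the P_(ebar j); the components of the
   bigrading are indexed by pairs of such restrictions. *)
definition deg_l :: "'n::finite hw \<Rightarrow> complex ^ 'n" where
  "deg_l \<alpha> = (\<chi> j. pairing \<alpha> (P_plus_h (ebar j)))"
definition deg_r :: "'n::finite hw \<Rightarrow> complex ^ 'n" where
  "deg_r \<beta> = (\<chi> j. pairing \<beta> (P_dyn (ebar j)))"

(* kappa is the structure map of an algebra over the ground field C((hbar)). *)
definition algebra_over :: "(complex fls \<Rightarrow> 'a::ring_1) \<Rightarrow> bool" where
  "algebra_over \<kappa> \<longleftrightarrow> \<kappa> 1 = 1 \<and> (\<forall>x y. \<kappa> (x + y) = \<kappa> x + \<kappa> y) \<and>
     (\<forall>x y. \<kappa> (x * y) = \<kappa> x * \<kappa> y) \<and> (\<forall>x a. \<kappa> x * a = a * \<kappa> x)"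

definition algebra_embedding :: "(complex fls \<Rightarrow> 'a::ring_1) \<Rightarrow> (complex fls \<Rightarrow> 'b::ring_1) \<Rightarrow> ('a \<Rightarrow> 'b) \<Rightarrow> bool" where
  "algebra_embedding \<kappa> \<kappa>' \<mu> \<longleftrightarrow> inj \<mu> \<and> \<mu> 1 = 1 \<and> (\<forall>f g. \<mu> (f + g) = \<mu> f + \<mu> g) \<and>
     (\<forall>f g. \<mu> (f * g) = \<mu> f * \<mu> g) \<and> (\<forall>c. \<mu> (\<kappa> c) = \<kappa>' c)"

(* For a topological algebra the direct sum is the topological one: every element is, uniquely,
   the sum of a convergent family of homogeneous components.  In a discrete algebra such a
   family has finite support, and this is the algebraic direct sum. *)
definition bigrading ::
  "(complex fls \<Rightarrow> 'a::{ring_1,topological_space}) \<Rightarrow> ('n::finite hw \<Rightarrow> 'n hw \<Rightarrow> 'a set) \<Rightarrow> bool" where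
  "bigrading \<kappa> A \<longleftrightarrow>
     (\<forall>\<alpha> \<beta>. 0 \<in> A \<alpha> \<beta> \<and> (\<forall>a\<in>A \<alpha> \<beta>. \<forall>b\<in>A \<alpha> \<beta>. a + b \<in> A \<alpha> \<beta>) \<and>
            (\<forall>c. \<forall>a\<in>A \<alpha> \<beta>. \<kappa> c * a \<in> A \<alpha> \<beta>)) \<and>
     (\<forall>\<alpha> \<alpha>' \<beta> \<beta>'. deg_l \<alpha> = deg_l \<alpha>' \<longrightarrow> deg_r \<beta> = deg_r \<beta>' \<longrightarrow> A \<alpha> \<beta> = A \<alpha>' \<beta>') \<and>
     1 \<in> A 0 0 \<and>
     (\<forall>\<alpha> \<beta> \<alpha>' \<beta>'. \<forall>a\<in>A \<alpha> \<beta>. \<forall>b\<in>A \<alpha>' \<beta>'. a * b \<in> A (\<alpha> + \<alpha>') (\<beta> + \<beta>')) \<and>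
     (\<forall>a. \<exists>!f. (\<forall>\<alpha> \<beta>. f (deg_l \<alpha>, deg_r \<beta>) \<in> A \<alpha> \<beta>) \<and>
               (\<forall>w. w \<notin> range deg_l \<times> range deg_r \<longrightarrow> f w = 0) \<and>
               (f has_sum a) (range deg_l \<times> range deg_r))"

(* The moment maps are defined on functions f of one set of dynamical variables that may depend
   on the nome (power series in it); see translate_hat for T_alpha in terms of f. *)
definition H_algebra ::
  "(complex fls \<Rightarrow> 'a::{ring_1,topological_space}) \<Rightarrow> ('n::finite hw \<Rightarrow> 'n hw \<Rightarrow> 'a set) \<Rightarrow>
     ('n M1 fps \<Rightarrow> 'a) \<Rightarrow> ('n M1 fps \<Rightarrow> 'a) \<Rightarrow> bool" where
  "H_algebra \<kappa> A \<mu>l \<mu>r \<longleftrightarrow>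
     algebra_over \<kappa> \<and> bigrading \<kappa> A \<and>
     algebra_embedding (\<lambda>c. fps_const (ground_const c)) \<kappa> \<mu>l \<and> range \<mu>l \<subseteq> A 0 0 \<and>
     algebra_embedding (\<lambda>c. fps_const (ground_const c)) \<kappa> \<mu>r \<and> range \<mu>r \<subseteq> A 0 0 \<and>
     (\<forall>\<alpha> \<beta>. \<forall>a\<in>A \<alpha> \<beta>. \<forall>f.
        \<mu>l f * a = a * \<mu>l (fps_map (shift (pt_Ph \<alpha>)) f) \<and>
        \<mu>r f * a = a * \<mu>r (fps_map (shift (pt_P \<beta>)) f))"

end

theory Submission
  imports Defs
begin

text \<open>
  Every word in the generators is homogeneous and exchanges with the functions of \<open>P + h\<close> and of
  \<open>P\<close> by the shift of its degree, so splitting a \<open>p\<close>-adic series of words by degree gives the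
  existence of homogeneous decompositions. Uniqueness does not need the weight-zero property of the
  \<open>R\<close>-matrix: the components are simultaneous eigenspaces of conjugation by \<open>q\<close> to the power
  \<open>P + h\<close> and \<open>P\<close>, with eigenvalues in the ground field, hence independent modulo every
  two-sided ideal, in particular modulo every power of \<open>p\<close>; and the intersection of these powers
  vanishes because the ideal of relations is closed. By uniqueness, an element of a component is
  a series of words of that degree, which gives the moment map identities for arbitrary meromorphic
  functions. The moment maps are injective because the character \<open>free_val\<close> kills the relations.
\<close>

section \<open>Meromorphic functions and their translations\<close>

lemma mcomp_add:
  assumes "affine_surj \<phi>" shows "mcomp \<phi> (f + g) = mcomp \<phi> f + mcomp \<phi> g"
  using assms
proof transfer
  fix \<phi> :: "'a \<Rightarrow> 'b" and f g :: "'b \<Rightarrow> complex" assume *: "affine_surj \<phi>" "meqv f f" "meqv g g"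
  hence "meromorphic_fun (\<lambda>x. f (\<phi> x) + g (\<phi> x))"
    using mero_comp[OF mero_add *(1)] by (simp add: meqv_def)
  thus "meqv (if affine_surj \<phi> then \<lambda>x. f (\<phi> x) + g (\<phi> x) else (\<lambda>_. 0))
      (\<lambda>x. (if affine_surj \<phi> then \<lambda>x. f (\<phi> x) else (\<lambda>_. 0)) x
         + (if affine_surj \<phi> then \<lambda>x. g (\<phi> x) else (\<lambda>_. 0)) x)"
    using *(1) by (simp add: meqv_def)
qed

lemma mcomp_mult:
  assumes "affine_surj \<phi>" shows "mcomp \<phi> (f * g) = mcomp \<phi> f * mcomp \<phi> g"
  using assms
proof transfer
  fix \<phi> :: "'a \<Rightarrow> 'b" and f g :: "'b \<Rightarrow> complex" assume *: "affine_surj \<phi>" "meqv f f" "meqv g g"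
  hence "meromorphic_fun (\<lambda>x. f (\<phi> x) * g (\<phi> x))"
    using mero_comp[OF mero_mult *(1)] by (simp add: meqv_def)
  thus "meqv (if affine_surj \<phi> then \<lambda>x. f (\<phi> x) * g (\<phi> x) else (\<lambda>_. 0))
      (\<lambda>x. (if affine_surj \<phi> then \<lambda>x. f (\<phi> x) else (\<lambda>_. 0)) x
         * (if affine_surj \<phi> then \<lambda>x. g (\<phi> x) else (\<lambda>_. 0)) x)"
    using *(1) by (simp add: meqv_def)
qed

lemma mcomp_mconst: "affine_surj \<phi> \<Longrightarrow> mcomp \<phi> (mconst c) = mconst c"
  by transfer (auto simp: meqv_def mero_const)

text \<open>Linearity of the form turns a translation of the argument into an additive constant;
  exponentiating this constant produces the eigenvalues of the grading.\<close>

lemma mcomp_dynvar: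
  "mcomp (\<lambda>s. s + v) (dynvar \<gamma>) = dynvar \<gamma> + mconst (wform v \<gamma>)"
proof -
  have h: "meromorphic_fun (\<lambda>s. wform s \<gamma>)" for \<gamma> :: "'a wt"
    by (rule mero_holo, unfold holo_at_def)
       (intro exI[of _ "\<lambda>s. wform s \<gamma>"] conjI bounded_linear_imp_has_derivative
          bounded_linear_wform, simp add: wform_cscale)
  show ?thesis
    using affine_surj_shift[of v]
    by transfer (simp add: meqv_def wform_add_left mero_add[OF h mero_const])
qed

section \<open>Field homomorphisms applied to the coefficients of series\<close>

definition field_hom :: "('a::field \<Rightarrow> 'b::field) \<Rightarrow> bool" where
  "field_hom \<phi> \<longleftrightarrow> \<phi> 1 = 1 \<and> (\<forall>x y. \<phi> (x + y) = \<phi> x + \<phi> y) \<and> (\<forall>x y. \<phi> (x * y) = \<phi> x * \<phi> y)"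

lemma field_hom_simps:
  assumes "field_hom \<phi>"
  shows "\<phi> 0 = 0" "\<phi> 1 = 1" "\<phi> (x + y) = \<phi> x + \<phi> y" "\<phi> (x * y) = \<phi> x * \<phi> y"
    "\<phi> (- x) = - \<phi> x" "\<phi> (x - y) = \<phi> x - \<phi> y" "\<phi> (x ^ n) = \<phi> x ^ n" "\<phi> (of_nat n) = of_nat n"
    "\<phi> (sum g A) = (\<Sum>i\<in>A. \<phi> (g i))" "\<phi> x = 0 \<longleftrightarrow> x = 0" "\<phi> (x / y) = \<phi> x / \<phi> y"
proof -
  show 1: "\<phi> 1 = 1" and add: "\<phi> (x + y) = \<phi> x + \<phi> y" and mult: "\<phi> (x * y) = \<phi> x * \<phi> y" for x y
    using assms unfolding field_hom_def by blast+
  show 0: "\<phi> 0 = 0" using add[of 0 0] by (simp only: add_0_right add_cancel_right_right)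
  show neg: "\<phi> (- x) = - \<phi> x" for x using add[of x "- x"] 0 by (simp add: add_eq_0_iff)
  show "\<phi> (x - y) = \<phi> x - \<phi> y" using add[of x "- y"] neg by simp
  show "\<phi> (x ^ n) = \<phi> x ^ n" by (induction n) (simp_all add: 1 mult)
  show "\<phi> (of_nat n) = of_nat n" by (induction n) (simp_all add: 0 1 add)
  show "\<phi> (sum g A) = (\<Sum>i\<in>A. \<phi> (g i))"
    by (induction A rule: infinite_finite_induct) (simp_all add: 0 add)
  show nz: "\<phi> x = 0 \<longleftrightarrow> x = 0" for x
  proof
    assume "\<phi> x = 0"
    hence "\<phi> (x * inverse x) = 0" by (simp add: mult)
    thus "x = 0" using 1 by (cases "x = 0") auto
  qed (use 0 in simp)
  have "\<phi> (x / y) * \<phi> y = \<phi> x" if "y \<noteq> 0" using mult[of "x / y" y] that by simp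
  thus "\<phi> (x / y) = \<phi> x / \<phi> y" by (cases "y = 0") (simp_all add: 0 nz eq_divide_eq)
qed

lemma field_hom_inj: "field_hom \<phi> \<Longrightarrow> inj \<phi>"
  by (rule injI) (metis eq_iff_diff_eq_0 field_hom_simps(6,10))

lemma field_hom_mcomp: "affine_surj \<phi> \<Longrightarrow> field_hom (mcomp \<phi>)"
  using mcomp_mconst[of \<phi> 1] by (simp add: field_hom_def mcomp_add mcomp_mult mconst_simps)

lemma field_hom_mconst: "field_hom mconst"
  by (simp add: field_hom_def mconst_simps)

lemma field_hom_fls_map:
  assumes "field_hom \<phi>" shows "field_hom (fls_map \<phi>)"
proof -
  note [simp] = field_hom_simps[OF assms]
  have nth: "fls_nth (fls_map \<phi> f) n = \<phi> (fls_nth f n)" for f n by (simp add: fls_map_nth)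
  \<comment> \<open>The product formula for Laurent series sums between bounds given by the
    subdegrees. They are preserved because \<open>\<phi>\<close> sends only 0 to 0.\<close>
  have sub: "fls_subdegree (fls_map \<phi> f) = fls_subdegree f" for f
  proof (cases "f = 0")
    case True
    have "fls_map \<phi> 0 = 0" by (rule fls_eqI) (simp add: nth)
    thus ?thesis using True by simp
  next
    case False thus ?thesis by (intro fls_subdegree_eqI) (simp_all add: nth)
  qed
  show ?thesis
    unfolding field_hom_def
    by (auto simp: fls_eq_iff nth fls_times_nth(1) sub)
qed

lemma fls_map_exp:
  fixes \<phi> :: "'a::field_char_0 \<Rightarrow> 'b::field_char_0"
  assumes "field_hom \<phi>"
  shows "fls_map \<phi> (fps_to_fls (fps_exp x)) = fps_to_fls (fps_exp (\<phi> x))"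
proof (rule fls_eqI)
  fix n
  \<comment> \<open>The coefficients of the exponential are \<open>x ^ m / fact m\<close>, and
    factorials are natural numbers, which \<open>\<phi>\<close> fixes.\<close>
  have "\<phi> (fact m) = fact m" for m
    using field_hom_simps(8)[OF assms, of "fact m"] by simp
  thus "fls_nth (fls_map \<phi> (fps_to_fls (fps_exp x))) n = fls_nth (fps_to_fls (fps_exp (\<phi> x))) n"
    using field_hom_simps[OF assms] by (simp add: fls_map_nth)
qed

lemma fps_map_nth [simp]: "fps_nth (fps_map \<phi> f) n = \<phi> (fps_nth f n)"
  by (simp add: fps_map_def)

lemma fps_map_hom:
  assumes "field_hom \<phi>"
  shows "fps_map \<phi> 1 = 1" "fps_map \<phi> (f + g) = fps_map \<phi> f + fps_map \<phi> g"
    "fps_map \<phi> (f * g) = fps_map \<phi> f * fps_map \<phi> g" "fps_map \<phi> (fps_const x) = fps_const (\<phi> x)"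
    "inj (fps_map \<phi>)"
proof -
  show "inj (fps_map \<phi>)"
    using field_hom_inj[OF assms] by (auto simp: inj_def fps_eq_iff)
qed (auto simp: fps_eq_iff fps_mult_nth fps_one_nth field_hom_simps[OF assms])

lemma field_hom_at_Ph: "field_hom at_Ph" and field_hom_at_P: "field_hom at_P"
  and field_hom_shift: "field_hom (shift v)" and field_hom_ground_const: "field_hom ground_const"
  unfolding at_Ph_def at_P_def shift_def ground_const_def
  by (intro field_hom_fls_map field_hom_mcomp field_hom_mconst affine_surj_fst affine_surj_snd
      affine_surj_shift)+

lemma mcomp_ground_const:
  "affine_surj \<phi> \<Longrightarrow> fls_map (mcomp \<phi>) (ground_const c) = ground_const c"
  unfolding ground_const_def
  by (rule fls_eqI)
     (simp add: fls_map_nth field_hom_simps(1)[OF field_hom_mcomp] mconst_simps mcomp_mconst)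

text \<open>Scalars do not involve the dynamical variables. This makes them central in the algebra
  and gives both moment maps the same restriction to the ground field.\<close>

lemma ground_const_invariant [simp]:
  "at_Ph (ground_const c) = ground_const c" "at_P (ground_const c) = ground_const c"
  "shift v (ground_const c) = ground_const c"
  unfolding at_Ph_def at_P_def shift_def
  by (intro mcomp_ground_const affine_surj_fst affine_surj_snd affine_surj_shift)+

lemma shift_shift: "shift u (shift v f) = shift (u + v) f"
proof (rule fls_eqI)
  fix n
  show "fls_nth (shift u (shift v f)) n = fls_nth (shift (u + v) f) n"
    unfolding shift_def
    by (simp add: fls_map_nth field_hom_simps(1)[OF field_hom_mcomp] affine_surj_shift mcomp_mcomp
        add.assoc)
qed

lemma shift_0 [simp]: "shift 0 f = f"
proof (rule fls_eqI)
  fix n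
  \<comment> \<open>\<open>mcomp\<close> returns 0 unless its map is \<open>affine_surj\<close>; the
    identity qualifies as the translation by 0.\<close>
  have "mcomp (\<lambda>s::'a wt. s) g = g" for g
    using affine_surj_shift[of "0::'a wt"] by transfer (auto simp: meqv_def)
  thus "fls_nth (shift 0 f) n = fls_nth f n"
    unfolding shift_def by (simp add: fls_map_nth)
qed

section \<open>Exponentials and their behaviour under translation\<close>

lemma qpow_add: "qpow (x + y) = qpow x * qpow y"
  by (simp add: qpow_def fps_exp_add_mult fls_times_fps_to_fls)

lemma qpow_0 [simp]: "qpow 0 = 1"
  by (simp add: qpow_def)

text \<open>This is q^c as an element of the ground field C((hbar)), with q = e^hbar.\<close>

definition exp_hbar :: "complex \<Rightarrow> complex fls" where
  "exp_hbar c = fps_to_fls (fps_exp c)"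

lemma qpow_mconst: "qpow (mconst c) = ground_const (exp_hbar c)"
  by (simp add: qpow_def ground_const_def exp_hbar_def fls_map_exp field_hom_mconst)

lemma exp_hbar_add: "exp_hbar (c + d) = exp_hbar c * exp_hbar d"
  by (simp add: exp_hbar_def fps_exp_add_mult fls_times_fps_to_fls)

lemma exp_hbar_0 [simp]: "exp_hbar 0 = 1"
  by (simp add: exp_hbar_def)

text \<open>The coefficient of hbar recovers the exponent. Here it matters that hbar is an
  indeterminate: a numerical q would determine exponents only up to periods of the
  exponential.\<close>

lemma exp_hbar_inject: "exp_hbar c = exp_hbar d \<longleftrightarrow> c = d"
proof
  assume "exp_hbar c = exp_hbar d"
  hence "fls_nth (exp_hbar c) 1 = fls_nth (exp_hbar d) 1" by simp
  thus "c = d" by (simp add: exp_hbar_def)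
qed simp

text \<open>The dynamical variable cancels and only a scalar remains. Thus exchanging an exponential
  with an element at the cost of a shift amounts to an eigenvalue equation for conjugation.\<close>

lemma shift_qpow:
  "shift v (qpow (dynvar \<gamma>)) * qpow (- dynvar \<gamma>) = ground_const (exp_hbar (wform v \<gamma>))"
proof -
  have "shift v (qpow (dynvar \<gamma>)) = qpow (dynvar \<gamma> + mconst (wform v \<gamma>))"
    unfolding shift_def qpow_def
    by (subst fls_map_exp[OF field_hom_mcomp[OF affine_surj_shift]]) (simp only: mcomp_dynvar)
  thus ?thesis by (simp flip: qpow_add qpow_mconst)
qed

text \<open>The correction -1/N in \<open>ebar j\<close> pairs with the coordinate sum of
  \<open>x\<close>, which is 0, so only the j-th coordinate survives.\<close>

lemma wform_ebar: "wform x (ebar j) = wt_vec x $ j"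
proof transfer
  fix x :: "complex ^ 'a" and j
  assume x: "(\<Sum>j\<in>UNIV. x $ j) = 0"
  have "(\<Sum>k\<in>UNIV. x $ k * (axis j 1 - (\<chi> k. 1 / of_nat CARD('a))) $ k)
      = (\<Sum>k\<in>UNIV. (if k = j then x $ k else 0) - x $ k * (1 / of_nat CARD('a)))"
    by (intro sum.cong) (auto simp: axis_def algebra_simps)
  also have "\<dots> = x $ j"
    by (simp only: sum_subtractf x flip: sum_distrib_right) simp
  finally show "(\<Sum>k\<in>UNIV. x $ k * (axis j 1 - (\<chi> k. 1 / of_nat CARD('a))) $ k) = x $ j" .
qed

text \<open>By \<open>wform_ebar\<close> the entries of a degree are the coordinates of the point.
  Hence the index of a component carries exactly the vector by which functions are shifted.\<close>

lemma deg_l_eq_iff: "deg_l \<alpha> = deg_l \<alpha>' \<longleftrightarrow> pt_Ph \<alpha> = pt_Ph \<alpha>'"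
  and deg_r_eq_iff: "deg_r \<beta> = deg_r \<beta>' \<longleftrightarrow> pt_P \<beta> = pt_P \<beta>'"
  by (auto simp: deg_l_def deg_r_def vec_eq_iff pairing_P_plus_h pairing_P_dyn wform_ebar
      simp flip: wt_vec_inject)

lemma pt_add: "pt_Ph (\<alpha> + \<beta>) = pt_Ph \<alpha> + pt_Ph \<beta>" "pt_P (\<alpha> + \<beta>) = pt_P \<alpha> + pt_P \<beta>"
  by (simp_all add: pt_Ph_def pt_P_def case_prod_unfold)

lemma pt_0 [simp]: "pt_Ph 0 = 0" "pt_P 0 = 0"
  by (simp_all add: pt_Ph_def pt_P_def case_prod_unfold)

lemma pt_uminus: "pt_Ph (- \<alpha>) = - pt_Ph \<alpha>" "pt_P (- \<alpha>) = - pt_P \<alpha>"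
  by (simp_all add: pt_Ph_def pt_P_def case_prod_unfold)

section \<open>Coefficientwise description of the elliptic algebra\<close>

lemma abs_ell_hom:
  "abs_ell (F + G) = abs_ell F + abs_ell G" "abs_ell (F * G) = abs_ell F * abs_ell G"
  "abs_ell (F - G) = abs_ell F - abs_ell G" "abs_ell (- F) = - abs_ell F"
  "abs_ell 0 = 0" "abs_ell 1 = 1"
  by (simp_all add: plus_ell.abs_eq times_ell.abs_eq minus_ell.abs_eq uminus_ell.abs_eq
      zero_ell_def one_ell_def)

lemma abs_ell_sum: "abs_ell (sum f A) = (\<Sum>x\<in>A. abs_ell (f x))"
  by (induction A rule: infinite_finite_induct) (simp_all add: abs_ell_hom)

lemma abs_ell_power: "abs_ell (F ^ n) = abs_ell F ^ n"
  by (induction n) (simp_all add: abs_ell_hom)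

lemma abs_ell_eq_iff: "abs_ell F = abs_ell G \<longleftrightarrow> F - G \<in> ell_ideal"
  by (simp add: ell.abs_eq_iff ell_rel_def)

lemma ell_rels_subset: "ell_rels \<subseteq> ell_ideal"
  unfolding ell_ideal_def by blast

lemma closed_ell_ideal: "closed ell_ideal"
  unfolding ell_ideal_def by (rule closed_Inter) blast

lemma abs_ell_surj: obtains F where "a = abs_ell F"
  using ell.abs_induct[of "\<lambda>x. \<exists>F. x = abs_ell F" a] by blast

lemma p_ell_commute: "p_ell ^ n * a = a * p_ell ^ n"
proof (induction a rule: ell.abs_induct)
  case (1 F)
  have "fps_X ^ n * F = F * fps_X ^ n"
    by (rule fps_mult_fps_X_power_commute)
  thus ?case unfolding p_ell_def by (simp flip: abs_ell_hom abs_ell_power)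
qed

text \<open>A representative is cut at order \<open>n\<close>, and \<open>fps_shift n F\<close> is
  its tail divided by p^n. If the coefficients vanish in the quotient, the element is therefore
  divisible by every power of p.\<close>

lemma p_ell_split:
  "\<exists>Y. abs_ell F = (\<Sum>m<n. p_ell ^ m * abs_ell (fps_const (fps_nth F m))) + p_ell ^ n * Y"
proof -
  have "F = (\<Sum>m<n. fps_X ^ m * fps_const (fps_nth F m)) + fps_X ^ n * fps_shift n F"
  proof (rule fps_ext)
    fix k
    have "(\<Sum>m<n. fps_nth (fps_X ^ m * fps_const (fps_nth F m)) k)
        = (\<Sum>m<n. if m = k then fps_nth F m else 0)"
      by (rule sum.cong) (auto simp: fps_X_power_mult_nth)
    thus "fps_nth F k = fps_nth ((\<Sum>m<n. fps_X ^ m * fps_const (fps_nth F m)) + fps_X ^ n * fps_shift n F) k"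
      by (auto simp: fps_sum_nth fps_X_power_mult_nth)
  qed
  hence "abs_ell F = abs_ell ((\<Sum>m<n. fps_X ^ m * fps_const (fps_nth F m)) + fps_X ^ n * fps_shift n F)"
    by simp
  thus ?thesis unfolding p_ell_def by (auto simp: abs_ell_hom abs_ell_sum abs_ell_power)
qed

text \<open>The ideal is closed, so a series outside it stays outside after any change of
  sufficiently high order in p. Divisibility by p^n modulo the ideal would allow such a change to
  lead into the ideal.\<close>

lemma ell_separated:
  assumes "\<And>n. \<exists>y. a = p_ell ^ n * y" shows "a = 0"
proof -
  obtain F where F: "a = abs_ell F" by (rule abs_ell_surj)
  have "F \<in> ell_ideal"
  proof (rule ccontr)
    assume "F \<notin> ell_ideal"
    moreover have "open (- ell_ideal :: 'a free set)" using closed_ell_ideal by (rule open_Compl)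
    ultimately obtain n where n: "{G. fps_cutoff n G = fps_cutoff n F} \<subseteq> - ell_ideal"
      unfolding open_fps_iff by blast
    obtain Y where "abs_ell F = p_ell ^ n * abs_ell Y"
      using assms[of n] F by (metis abs_ell_surj)
    hence "F - fps_X ^ n * Y \<in> ell_ideal"
      by (simp add: p_ell_def flip: abs_ell_eq_iff abs_ell_hom abs_ell_power)
    moreover have "fps_cutoff n (F - fps_X ^ n * Y) = fps_cutoff n F"
      by (simp add: fps_eq_iff fps_X_power_mult_nth)
    ultimately show False using n by blast
  qed
  thus ?thesis unfolding F using abs_ell_eq_iff[of F 0] by (simp add: abs_ell_hom)
qed

section \<open>Reduction of p-adic identities to their coefficients\<close>

definition ell_coeff :: "('n::{finite,linorder} gen list \<Rightarrow>\<^sub>0 int) \<Rightarrow> 'n ell" where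
  "ell_coeff P = abs_ell (fps_const P)"

lemma ell_coeff_hom:
  "ell_coeff (P + Q) = ell_coeff P + ell_coeff Q" "ell_coeff (P * Q) = ell_coeff P * ell_coeff Q"
  "ell_coeff 0 = 0" "ell_coeff 1 = 1" "ell_coeff (P - Q) = ell_coeff P - ell_coeff Q"
  "ell_coeff (- P) = - ell_coeff P"
  by (simp_all add: ell_coeff_def abs_ell_hom flip: fps_const_add fps_const_mult fps_const_sub fps_const_neg)

lemma ell_coeff_sum: "ell_coeff (sum f A) = (\<Sum>x\<in>A. ell_coeff (f x))"
  by (induction A rule: infinite_finite_induct) (simp_all add: ell_coeff_hom)

lemma ell_coeff_power: "ell_coeff (P ^ n) = ell_coeff P ^ n"
  by (induction n) (simp_all add: ell_coeff_hom)

text \<open>Each coefficient is reduced modulo the relations separately. The variable of this series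
  only records the order and is distinct from the element \<open>p_ell\<close> of the
  quotient.\<close>

definition ell_series :: "'n::{finite,linorder} free \<Rightarrow> 'n ell fps" where
  "ell_series = fps_map ell_coeff"

lemma ell_series_nth: "fps_nth (ell_series F) n = ell_coeff (fps_nth F n)"
  by (simp add: ell_series_def)

lemma ell_series_hom:
  "ell_series (F * G) = ell_series F * ell_series G" "ell_series (F + G) = ell_series F + ell_series G"
  "ell_series 1 = 1"
  by (auto simp: fps_eq_iff ell_series_nth fps_mult_nth ell_coeff_hom ell_coeff_sum fps_one_nth)

text \<open>Every truncation of the difference vanishes, so it is divisible by all powers of p and
  \<open>ell_separated\<close> applies. Identities between infinite series thereby reduce to
  identities between finite combinations of words.\<close>

lemma abs_ell_eqI:
  assumes "ell_series F = ell_series G" shows "abs_ell F = abs_ell G"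
proof -
  have c: "abs_ell (fps_const (fps_nth (F - G) m)) = 0" for m
    using arg_cong[OF assms, of "\<lambda>f. fps_nth f m"]
    by (simp add: ell_series_nth ell_coeff_def abs_ell_hom flip: fps_const_sub)
  have "abs_ell (F - G) = 0"
  proof (rule ell_separated)
    fix n show "\<exists>y. abs_ell (F - G) = p_ell ^ n * y"
      using p_ell_split[of "F - G" n] by (simp del: fps_sub_nth add: c)
  qed
  thus ?thesis by (simp add: abs_ell_hom)
qed

definition ell_gen :: "'n::{finite,linorder} gen \<Rightarrow> 'n ell" where
  "ell_gen x = abs_ell (gen_elt x)"

lemma ell_coeff_single: "ell_coeff (Poly_Mapping.single w c) = of_int c * prod_list (map ell_gen w)"
proof -
  have w: "ell_coeff (Poly_Mapping.single w 1) = prod_list (map ell_gen w)" for w :: "'a gen list"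
  proof (induction w)
    case Nil thus ?case using ell_coeff_hom(4) by (simp add: zero_list_def flip: single_one)
  next
    case (Cons x w)
    have "Poly_Mapping.single (x # w) (1::int) = Poly_Mapping.single [x] 1 * Poly_Mapping.single w 1"
      by (simp add: mult_single plus_list_def)
    thus ?case
      by (simp add: ell_coeff_hom Cons ell_gen_def gen_elt_def) (simp add: ell_coeff_def)
  qed
  have n: "ell_coeff (of_nat n) = (of_nat n :: 'a ell)" for n
    by (induction n) (simp_all add: ell_coeff_hom)
  have i: "ell_coeff (of_int i) = (of_int i :: 'a ell)" for i
    by (cases i rule: int_cases2) (simp_all add: ell_coeff_hom n)
  have "Poly_Mapping.single w c = of_int c * Poly_Mapping.single w 1"
    by (simp add: mult_single flip: single_of_int)
  thus ?thesis by (simp add: ell_coeff_hom i w)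
qed

section \<open>Coefficient functions and the two structure maps\<close>

definition ell_fun :: "'n::{finite,linorder} FF \<Rightarrow> 'n ell" where
  "ell_fun f = ell_gen (Coef f)"

lemma ell_relI: "F - G \<in> ell_rels \<Longrightarrow> abs_ell F = abs_ell G"
  using ell_rels_subset by (auto simp: abs_ell_eq_iff)

lemma ell_fun_hom:
  fixes f g :: "'n::{finite,linorder} FF"
  shows "ell_fun (1 :: 'n FF) = 1" "ell_fun (f + g) = ell_fun f + ell_fun g" "ell_fun (f * g) = ell_fun f * ell_fun g"
  "ell_fun (0 :: 'n FF) = 0"
proof -
  show 1: "ell_fun (1 :: 'n FF) = 1" and add: "ell_fun (f + g) = ell_fun f + ell_fun g"
    and "ell_fun (f * g) = ell_fun f * ell_fun g" for f g :: "'n FF"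
    unfolding ell_fun_def ell_gen_def abs_ell_hom[symmetric]
    by (intro ell_relI ell_rels.intros)+
  show "ell_fun 0 = (0 :: 'n ell)" using add[of 0 0] by (simp only: add_0_right add_cancel_right_right)
qed

lemma ell_fun_sum: "ell_fun (sum f A) = (\<Sum>x\<in>A. ell_fun (f x))"
  by (induction A rule: infinite_finite_induct) (simp_all add: ell_fun_hom)

lemma Cneg_central: "ell_gen Cneg * ell_gen x = ell_gen x * ell_gen Cneg"
  and Cpos_central: "ell_gen Cpos * ell_gen x = ell_gen x * ell_gen Cpos"
  and Coef_at_Ph_Lgen: "ell_fun (at_Ph g) * ell_gen (Lgen i j n)
     = ell_gen (Lgen i j n) * ell_fun (at_Ph (shift (- pt_Ph (Q_dyn (ebar i))) g))"
  and Coef_at_P_Lgen: "ell_fun (at_P g) * ell_gen (Lgen i j n)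
     = ell_gen (Lgen i j n) * ell_fun (at_P (shift (- pt_P (Q_dyn (ebar j))) g))"
  and Dgen_Coef: "ell_gen Dgen * ell_fun f = ell_fun f * ell_gen Dgen"
  unfolding ell_fun_def ell_gen_def abs_ell_hom[symmetric]
  by (intro ell_relI ell_rels.intros)+

lemma ell_fun_commute: "ell_fun f * ell_fun g = ell_fun g * ell_fun f"
  by (metis ell_fun_hom(3) mult.commute)

lemma ell_series_emb: "ell_series (emb f) = fps_map ell_fun f"
  by (simp add: fps_eq_iff ell_series_nth emb_def ell_coeff_single ell_fun_def)

text \<open>The factor 4 arises since pstar = p q^(-2c), while \<open>Cneg\<close> stands for
  q^(-c/2).\<close>

lemma ell_series_emb_star:
  "fps_nth (ell_series (emb_star f)) m = ell_fun (fps_nth f m) * ell_gen Cneg ^ (4 * m)"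
  by (simp add: ell_series_nth emb_star_def ell_coeff_single ell_coeff_hom ell_coeff_power ell_fun_def)

lemma Cneg_power_commute: "ell_gen Cneg ^ k * ell_gen x = ell_gen x * ell_gen Cneg ^ k"
  by (metis Cneg_central power_commuting_commutes)

lemma ser_hom:
  "ser 1 = 1" "ser (f + g) = ser f + ser g" "ser (f * g) = ser f * ser g"
  unfolding ser_def abs_ell_hom[symmetric]
  by (intro abs_ell_eqI;
      auto simp: fps_eq_iff ell_series_hom ell_series_emb fps_mult_nth fps_one_nth ell_fun_hom ell_fun_sum)+

text \<open>In the Cauchy product the power of \<open>Cneg\<close> attached to order
  \<open>m\<close> splits into those attached to \<open>i\<close> and \<open>m - i\<close>, and
  centrality lets one of them pass the second function.\<close>

lemma ser_star_hom:
  "ser_star 1 = 1" "ser_star (f + g) = ser_star f + ser_star g"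
  "ser_star (f * g) = ser_star f * (ser_star g :: 'n::{finite,linorder} ell)"
proof -
  have "ell_fun a * ell_fun b * ell_gen Cneg ^ (4 * m)
      = ell_fun a * ell_gen Cneg ^ (4 * i) * (ell_fun b * ell_gen Cneg ^ (4 * (m - i)))"
    if "i \<le> m" for a b :: "'n FF" and i m
  proof -
    have "4 * m = 4 * i + 4 * (m - i)" using that by simp
    thus ?thesis by (metis (no_types) power_add mult.assoc ell_fun_def Cneg_power_commute)
  qed
  thus "ser_star (f * g) = ser_star f * ser_star g"
    unfolding ser_star_def abs_ell_hom[symmetric]
    by (intro abs_ell_eqI)
       (auto simp: fps_eq_iff ell_series_hom ell_series_emb_star fps_mult_nth ell_fun_hom ell_fun_sum
          sum_distrib_right intro!: sum.cong)
qed (unfold ser_star_def abs_ell_hom[symmetric];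
      rule abs_ell_eqI;
      auto simp: fps_eq_iff ell_series_hom ell_series_emb_star fps_one_nth ell_fun_hom distrib_right)+

lemma ser_star_const: "ser_star (fps_const x) = ser (fps_const x)"
  unfolding ser_def ser_star_def
  by (rule abs_ell_eqI) (auto simp: fps_eq_iff ell_series_emb ell_series_emb_star ell_fun_hom)

text \<open>\<open>free_val\<close> is a left inverse of both \<open>emb\<close> and
  \<open>emb_star\<close>, and it descends to the quotient because it vanishes on the ideal.\<close>

lemma ser_inj: "inj (ser :: 'n::{finite,linorder} FF fps \<Rightarrow> 'n ell)"
  and ser_star_inj: "inj (ser_star :: 'n::{finite,linorder} FF fps \<Rightarrow> 'n ell)"
proof -
  have "free_val F = free_val G" if "abs_ell F = abs_ell G" for F G :: "'n free"
    using free_val_ell_ideal[of "F - G"] that by (simp add: abs_ell_eq_iff)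
  thus "inj (ser :: 'n FF fps \<Rightarrow> 'n ell)" "inj (ser_star :: 'n FF fps \<Rightarrow> 'n ell)"
    unfolding ser_def ser_star_def inj_def by (metis free_val_emb free_val_emb_star)+
qed

lemma mu_l_hom:
  "mu_l 1 = 1" "mu_l (f + g) = mu_l f + mu_l g" "mu_l (f * g) = mu_l f * mu_l g"
  and mu_r_hom:
  "mu_r 1 = 1" "mu_r (f + g) = mu_r f + mu_r g" "mu_r (f * g) = mu_r f * mu_r g"
  by (simp_all add: mu_l_def mu_r_def fps_map_hom[OF field_hom_at_Ph] fps_map_hom[OF field_hom_at_P]
      ser_hom ser_star_hom)

lemma mu_l_inj: "inj mu_l" and mu_r_inj: "inj mu_r"
  unfolding mu_l_def mu_r_def
  using inj_compose[OF ser_inj fps_map_hom(5)[OF field_hom_at_Ph]]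
    inj_compose[OF ser_star_inj fps_map_hom(5)[OF field_hom_at_P]]
  by (simp_all add: o_def)

lemma mu_const:
  "mu_l (fps_const x) = ser (fps_const (at_Ph x))" "mu_r (fps_const x) = ser (fps_const (at_P x))"
  by (simp_all add: mu_l_def mu_r_def fps_map_hom[OF field_hom_at_Ph] fps_map_hom[OF field_hom_at_P]
      ser_star_const)

lemma mu_ground_const:
  "mu_l (fps_const (ground_const c)) = ell_const c" "mu_r (fps_const (ground_const c)) = ell_const c"
  by (simp_all add: mu_const ell_const_def)

section \<open>Grading by words and eigenspaces\<close>

definition word_elt :: "'n::{finite,linorder} gen list \<Rightarrow> 'n ell" where
  "word_elt w = prod_list (map ell_gen w)"

lemma ell_coeff_eq:
  "ell_coeff P = (\<Sum>w\<in>Poly_Mapping.keys P. of_int (Poly_Mapping.lookup P w) * word_elt w)"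
  by (subst poly_mapping_sum_single[of P]) (simp add: ell_coeff_sum ell_coeff_single word_elt_def)

lemma ell_coeff_exchange:
  assumes "\<And>w. w \<in> Poly_Mapping.keys P \<Longrightarrow> a * word_elt w = word_elt w * b"
  shows "a * ell_coeff P = ell_coeff P * b"
proof -
  have "a * (of_int k * word_elt w) = of_int k * word_elt w * b" if "w \<in> Poly_Mapping.keys P" for k w
    using assms[OF that] by (metis mult.assoc mult_of_int_commute)
  thus ?thesis by (simp add: ell_coeff_eq sum_distrib_left sum_distrib_right)
qed

text \<open>The partner of each coefficient of \<open>f\<close> is the same for all words of
  \<open>G\<close>, so the exchange extends linearly from words to coefficients and then to Cauchy
  products. The powers of \<open>Cneg\<close> in the starred version are central.\<close>

lemma ser_exchange:
  assumes "\<And>i m w. w \<in> Poly_Mapping.keys (fps_nth G m) \<Longrightarrow>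
    ell_fun (fps_nth f i) * word_elt w = word_elt w * ell_fun (fps_nth g i)"
  shows "ser f * abs_ell G = abs_ell G * ser g" "ser_star f * abs_ell G = abs_ell G * ser_star g"
proof -
  have c: "ell_fun (fps_nth f i) * ell_coeff (fps_nth G m) = ell_coeff (fps_nth G m) * ell_fun (fps_nth g i)"
    for i m using assms by (intro ell_coeff_exchange)
  have "ell_gen Cneg ^ k * word_elt w = word_elt w * ell_gen Cneg ^ k" for k w
  proof (induction w)
    case (Cons x w)
    have "ell_gen Cneg ^ k * word_elt (x # w) = ell_gen x * (ell_gen Cneg ^ k * word_elt w)"
      by (simp add: word_elt_def Cneg_power_commute flip: mult.assoc)
    also have "\<dots> = word_elt (x # w) * ell_gen Cneg ^ k"
      unfolding Cons by (simp add: word_elt_def mult.assoc)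
    finally show ?case .
  qed (simp add: word_elt_def)
  hence N: "ell_gen Cneg ^ k * ell_coeff P = ell_coeff P * ell_gen Cneg ^ k" for k P
    by (intro ell_coeff_exchange)
  hence cs: "ell_fun (fps_nth f i) * ell_gen Cneg ^ k * ell_coeff (fps_nth G m)
      = ell_coeff (fps_nth G m) * (ell_fun (fps_nth g i) * ell_gen Cneg ^ k)" for i k m
    by (simp only: mult.assoc N) (simp only: c flip: mult.assoc)
  show "ser f * abs_ell G = abs_ell G * ser g"
    unfolding ser_def abs_ell_hom[symmetric]
  proof (rule abs_ell_eqI, rule fps_ext)
    fix m
    show "fps_nth (ell_series (emb f * G)) m = fps_nth (ell_series (G * emb g)) m"
      \<comment> \<open>The index of \<open>G\<close> is the second one in the left product and the
        first one in the right product, hence the reversal of the summation.\<close>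
      unfolding ell_series_hom fps_mult_nth ell_series_nth[of G]
      by (rule sum.reindex_bij_witness[of _ "\<lambda>i. m - i" "\<lambda>i. m - i"])
         (auto simp: ell_series_emb c)
  qed
  show "ser_star f * abs_ell G = abs_ell G * ser_star g"
    unfolding ser_star_def abs_ell_hom[symmetric]
  proof (rule abs_ell_eqI, rule fps_ext)
    fix m
    show "fps_nth (ell_series (emb_star f * G)) m = fps_nth (ell_series (G * emb_star g)) m"
      unfolding ell_series_hom fps_mult_nth ell_series_nth[of G]
      by (rule sum.reindex_bij_witness[of _ "\<lambda>i. m - i" "\<lambda>i. m - i"])
         (auto simp: ell_series_emb_star cs)
  qed
qed

primrec gen_deg :: "'n::finite gen \<Rightarrow> 'n hw \<times> 'n hw" where
  "gen_deg (Coef f) = 0"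
| "gen_deg (Lgen i j n) = (- Q_dyn (ebar i), - Q_dyn (ebar j))"
| "gen_deg Dgen = 0"
| "gen_deg Cpos = 0"
| "gen_deg Cneg = 0"

definition word_deg :: "'n::finite gen list \<Rightarrow> (complex ^ 'n) \<times> (complex ^ 'n)" where
  "word_deg w = (let d = sum_list (map gen_deg w) in (deg_l (fst d), deg_r (snd d)))"

text \<open>For the modes of L this is a defining relation. All other generators commute with
  functions and have degree 0, where the shift is trivial.\<close>

lemma gen_exchange:
  fixes x :: "'n::{finite,linorder} gen"
  shows
  "ell_fun (at_Ph g) * ell_gen x = ell_gen x * ell_fun (at_Ph (shift (pt_Ph (fst (gen_deg x))) g))"
  "ell_fun (at_P g) * ell_gen x = ell_gen x * ell_fun (at_P (shift (pt_P (snd (gen_deg x))) g))"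
proof -
  have *: "ell_fun f * ell_gen Dgen = ell_gen Dgen * ell_fun f"
    "ell_fun f * ell_gen Cpos = ell_gen Cpos * ell_fun f"
    "ell_fun f * ell_gen Cneg = ell_gen Cneg * ell_fun f"
    "ell_fun f * ell_gen (Coef g) = ell_gen (Coef g) * ell_fun f" for f g :: "'n FF"
    using Dgen_Coef[of f] Cpos_central[of "Coef f"] Cneg_central[of "Coef f"] ell_fun_commute[of f g]
    unfolding ell_fun_def by simp_all
  show "ell_fun (at_Ph g) * ell_gen x = ell_gen x * ell_fun (at_Ph (shift (pt_Ph (fst (gen_deg x))) g))"
    by (cases x) (simp_all only: gen_deg.simps fst_conv fst_zero pt_0 shift_0 * pt_uminus Coef_at_Ph_Lgen)
  show "ell_fun (at_P g) * ell_gen x = ell_gen x * ell_fun (at_P (shift (pt_P (snd (gen_deg x))) g))"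
    by (cases x) (simp_all only: gen_deg.simps snd_conv snd_zero pt_0 shift_0 * pt_uminus Coef_at_P_Lgen)
qed

text \<open>Each letter shifts the function before it meets the next one, so the induction runs over
  all \<open>g\<close>; by \<open>shift_shift\<close> the shifts add up to the degree of the
  word.\<close>

lemma word_exchange:
  "ell_fun (at_Ph g) * word_elt w
    = word_elt w * ell_fun (at_Ph (shift (pt_Ph (fst (sum_list (map gen_deg w)))) g))" (is "?l g w")
  "ell_fun (at_P g) * word_elt w
    = word_elt w * ell_fun (at_P (shift (pt_P (snd (sum_list (map gen_deg w)))) g))" (is "?r g w")
proof -
  show "?l g w"
  proof (induction w arbitrary: g)
    case (Cons x w)
    let ?u = "pt_Ph (fst (gen_deg x))" and ?v = "pt_Ph (fst (sum_list (map gen_deg w)))"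
    have "ell_fun (at_Ph g) * word_elt (x # w) = ell_gen x * (ell_fun (at_Ph (shift ?u g)) * word_elt w)"
      using gen_exchange(1)[of g x] by (simp add: word_elt_def flip: mult.assoc)
    also have "\<dots> = word_elt (x # w) * ell_fun (at_Ph (shift (?v + ?u) g))"
      unfolding Cons shift_shift by (simp add: word_elt_def mult.assoc)
    finally show ?case by (simp add: pt_add add.commute)
  qed (simp add: word_elt_def)
  show "?r g w"
  proof (induction w arbitrary: g)
    case (Cons x w)
    let ?u = "pt_P (snd (gen_deg x))" and ?v = "pt_P (snd (sum_list (map gen_deg w)))"
    have "ell_fun (at_P g) * word_elt (x # w) = ell_gen x * (ell_fun (at_P (shift ?u g)) * word_elt w)"
      using gen_exchange(2)[of g x] by (simp add: word_elt_def flip: mult.assoc)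
    also have "\<dots> = word_elt (x # w) * ell_fun (at_P (shift (?v + ?u) g))"
      unfolding Cons shift_shift by (simp add: word_elt_def mult.assoc)
    finally show ?case by (simp add: pt_add add.commute)
  qed (simp add: word_elt_def)
qed

lemma homogeneous_exchange:
  assumes "\<And>m w. w \<in> Poly_Mapping.keys (fps_nth G m) \<Longrightarrow> word_deg w = (deg_l \<alpha>, deg_r \<beta>)"
  shows "mu_l f * abs_ell G = abs_ell G * mu_l (fps_map (shift (pt_Ph \<alpha>)) f)"
    "mu_r f * abs_ell G = abs_ell G * mu_r (fps_map (shift (pt_P \<beta>)) f)"
proof -
  have *: "pt_Ph (fst (sum_list (map gen_deg w))) = pt_Ph \<alpha>"
    "pt_P (snd (sum_list (map gen_deg w))) = pt_P \<beta>"
    if "w \<in> Poly_Mapping.keys (fps_nth G m)" for m w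
    using assms[OF that] by (simp_all add: word_deg_def Let_def deg_l_eq_iff deg_r_eq_iff)
  show "mu_l f * abs_ell G = abs_ell G * mu_l (fps_map (shift (pt_Ph \<alpha>)) f)"
    unfolding mu_l_def by (rule ser_exchange(1)) (simp add: word_exchange(1) *(1))
  show "mu_r f * abs_ell G = abs_ell G * mu_r (fps_map (shift (pt_P \<beta>)) f)"
    unfolding mu_r_def by (rule ser_exchange(2)) (simp add: word_exchange(2) *(2))
qed

section \<open>Scalars, and the components as joint eigenspaces\<close>

lemma ell_const_1 [simp]: "ell_const 1 = 1"
  and ell_const_add: "ell_const (x + y) = ell_const x + ell_const y"
  and ell_const_mult: "ell_const (x * y) = ell_const x * ell_const y"
  by (simp_all add: ell_const_def field_hom_simps(2-4)[OF field_hom_ground_const] ser_hom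
      flip: fps_const_add fps_const_mult)

text \<open>A scalar is a function of P+h unchanged by every shift, so it passes through each word
  unaltered.\<close>

lemma ell_const_central: "ell_const x * a = a * ell_const x"
proof -
  obtain G where G: "a = abs_ell G" by (rule abs_ell_surj)
  have "ell_fun (ground_const x) * word_elt w = word_elt w * ell_fun (ground_const x)"
    for w :: "'a gen list"
    using word_exchange(1)[of "ground_const x" w] by simp
  thus ?thesis
    unfolding G ell_const_def by (intro ser_exchange) (simp add: ell_fun_hom)
qed

lemma ell_const_left_commute: "a * (ell_const c * b) = ell_const c * (a * b)"
  by (simp only: ell_const_central[of c a] flip: mult.assoc)

lemma algebra_over_ell_const: "algebra_over ell_const"
  unfolding algebra_over_def
  by (intro conjI allI ell_const_1 ell_const_add ell_const_mult ell_const_central)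

text \<open>The exponentials of P+h and those of P are put into one family over a sum type, so that
  both conditions in \<open>ell_comp\<close> become a single eigenvalue condition.\<close>

definition torus :: "'n::{finite,linorder} wt + 'n wt \<Rightarrow> 'n ell" where
  "torus = case_sum (\<lambda>\<gamma>. mu_l (fps_const (qpow (dynvar \<gamma>)))) (\<lambda>\<gamma>. mu_r (fps_const (qpow (dynvar \<gamma>))))"

definition torus_inv :: "'n::{finite,linorder} wt + 'n wt \<Rightarrow> 'n ell" where
  "torus_inv = case_sum (\<lambda>\<gamma>. mu_l (fps_const (qpow (- dynvar \<gamma>)))) (\<lambda>\<gamma>. mu_r (fps_const (qpow (- dynvar \<gamma>))))"

definition weight :: "'n::finite hw \<Rightarrow> 'n hw \<Rightarrow> 'n wt + 'n wt \<Rightarrow> complex" where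
  "weight \<alpha> \<beta> = case_sum (\<lambda>\<gamma>. pairing \<alpha> (P_plus_h \<gamma>)) (\<lambda>\<gamma>. pairing \<beta> (P_dyn \<gamma>))"

lemma ell_comp_iff:
  "a \<in> ell_comp \<alpha> \<beta> \<longleftrightarrow>
    (\<forall>i. torus i * a * torus_inv i = ell_const (exp_hbar (weight \<alpha> \<beta> i)) * a)"
  by (simp add: ell_comp_def split_sum_all torus_def torus_inv_def weight_def mu_const ell_const_def
      qpow_mconst)

lemma torus_inverse: "torus i * torus_inv i = 1" "torus_inv i * torus i = 1"
  by (cases i; simp add: torus_def torus_inv_def fps_const_mult mu_l_hom mu_r_hom
      flip: mu_l_hom(3) mu_r_hom(3) qpow_add)+

lemma weight_add: "weight (\<alpha> + \<alpha>') (\<beta> + \<beta>') i = weight \<alpha> \<beta> i + weight \<alpha>' \<beta>' i"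
  by (cases i) (simp_all add: weight_def pairing_P_plus_h pairing_P_dyn pt_add wform_add_left)

lemma weight_0 [simp]: "weight 0 0 i = 0"
  by (cases i) (simp_all add: weight_def pairing_P_plus_h pairing_P_dyn)

text \<open>Taking the \<open>ebar j\<close> as arguments recovers the degrees. Conversely the
  degrees determine the points \<open>pt_Ph \<alpha>\<close> and \<open>pt_P \<beta>\<close>, and
  with them all weights.\<close>

lemma weight_eq_iff:
  "(\<forall>i. weight \<alpha> \<beta> i = weight \<alpha>' \<beta>' i) \<longleftrightarrow> deg_l \<alpha> = deg_l \<alpha>' \<and> deg_r \<beta> = deg_r \<beta>'"
proof
  assume "\<forall>i. weight \<alpha> \<beta> i = weight \<alpha>' \<beta>' i"
  thus "deg_l \<alpha> = deg_l \<alpha>' \<and> deg_r \<beta> = deg_r \<beta>'"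
    by (simp add: split_sum_all weight_def deg_l_def deg_r_def)
next
  assume "deg_l \<alpha> = deg_l \<alpha>' \<and> deg_r \<beta> = deg_r \<beta>'"
  thus "\<forall>i. weight \<alpha> \<beta> i = weight \<alpha>' \<beta>' i"
    by (simp add: split_sum_all weight_def pairing_P_plus_h pairing_P_dyn deg_l_eq_iff deg_r_eq_iff)
qed

text \<open>Membership tests exponentials only, and for these \<open>shift_qpow\<close> turns the
  exchange rule into the eigenvalue equation. The converse, \<open>ell_comp_exchange\<close>, is
  much deeper.\<close>

lemma ell_compI:
  assumes "\<And>f. mu_l f * a = a * mu_l (fps_map (shift (pt_Ph \<alpha>)) f)"
    "\<And>f. mu_r f * a = a * mu_r (fps_map (shift (pt_P \<beta>)) f)"
  shows "a \<in> ell_comp \<alpha> \<beta>"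
  unfolding ell_comp_iff
proof
  fix i :: "'a wt + 'a wt"
  note [simp] = fps_map_hom(4)[OF field_hom_shift] shift_qpow mu_ground_const
  show "torus i * a * torus_inv i = ell_const (exp_hbar (weight \<alpha> \<beta> i)) * a"
    by (cases i)
      (simp_all add: torus_def torus_inv_def weight_def pairing_P_plus_h pairing_P_dyn assms mult.assoc
        fps_const_mult ell_const_central flip: mu_l_hom(3) mu_r_hom(3))
qed

text \<open>A torus element is a series without p, hence a value of \<open>ser\<close> and of
  \<open>ser_star\<close> alike. Each of these has commutative image, so the torus commutes with
  both ranges.\<close>

lemma range_mu:
  "range (mu_l :: 'n::{finite,linorder} M1 fps \<Rightarrow> _) \<subseteq> ell_comp 0 0"
  "range (mu_r :: 'n::{finite,linorder} M1 fps \<Rightarrow> _) \<subseteq> ell_comp 0 0"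
proof -
  have c: "ser f * ser g = ser g * ser f" "ser_star f * ser_star g = ser_star g * ser_star f"
    for f g :: "'n FF fps"
    by (simp_all add: mult.commute flip: ser_hom(3) ser_star_hom(3))
  have "torus i * ser g = ser g * torus i \<and> torus i * ser_star g = ser_star g * torus i"
    for i and g :: "'n FF fps"
  proof -
    obtain x where "torus i = ser (fps_const x)" "torus i = ser_star (fps_const x)"
      by (cases i) (auto simp: torus_def mu_const ser_star_const)
    thus ?thesis using c by metis
  qed
  hence "ser g \<in> ell_comp 0 0" "ser_star g \<in> ell_comp 0 0" for g :: "'n FF fps"
    by (simp_all add: ell_comp_iff mult.assoc torus_inverse)
  thus "range (mu_l :: 'n M1 fps \<Rightarrow> _) \<subseteq> ell_comp 0 0" "range (mu_r :: 'n M1 fps \<Rightarrow> _) \<subseteq> ell_comp 0 0"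
    by (auto simp: mu_l_def mu_r_def)
qed

lemma ell_comp_closed:
  "0 \<in> ell_comp \<alpha> \<beta>" "1 \<in> ell_comp 0 0"
  "a \<in> ell_comp \<alpha> \<beta> \<Longrightarrow> b \<in> ell_comp \<alpha> \<beta> \<Longrightarrow> a + b \<in> ell_comp \<alpha> \<beta>"
  "a \<in> ell_comp \<alpha> \<beta> \<Longrightarrow> b \<in> ell_comp \<alpha> \<beta> \<Longrightarrow> a - b \<in> ell_comp \<alpha> \<beta>"
  by (simp_all add: ell_comp_iff torus_inverse distrib_left distrib_right left_diff_distrib right_diff_distrib)

lemma ell_comp_mult:
  assumes "a \<in> ell_comp \<alpha> \<beta>" "b \<in> ell_comp \<alpha>' \<beta>'"
  shows "a * b \<in> ell_comp (\<alpha> + \<alpha>') (\<beta> + \<beta>')"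
  unfolding ell_comp_iff
proof
  fix i :: "'a wt + 'a wt"
  let ?t = "torus i" and ?s = "torus_inv i"
  have "?t * (a * b) * ?s = (?t * a * ?s) * (?t * b * ?s)"
  proof -
    have "?s * (?t * x) = x" for x by (simp add: torus_inverse flip: mult.assoc)
    thus ?thesis by (simp only: mult.assoc)
  qed
  also have "\<dots> = ell_const (exp_hbar (weight \<alpha> \<beta> i)) * a * (ell_const (exp_hbar (weight \<alpha>' \<beta>' i)) * b)"
    using assms by (simp add: ell_comp_iff)
  also have "\<dots> = ell_const (exp_hbar (weight (\<alpha> + \<alpha>') (\<beta> + \<beta>') i)) * (a * b)"
    by (simp only: weight_add exp_hbar_add ell_const_mult mult.assoc ell_const_left_commute[of a])
  finally show "?t * (a * b) * ?s = ell_const (exp_hbar (weight (\<alpha> + \<alpha>') (\<beta> + \<beta>') i)) * (a * b)" .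
qed

lemma ell_comp_scale:
  assumes "a \<in> ell_comp \<alpha> \<beta>" shows "ell_const c * a \<in> ell_comp \<alpha> \<beta>"
  unfolding ell_comp_iff
proof
  fix i :: "'a wt + 'a wt"
  let ?e = "exp_hbar (weight \<alpha> \<beta> i)"
  have "torus i * (ell_const c * a) * torus_inv i = ell_const c * (torus i * a * torus_inv i)"
    by (simp only: mult.assoc ell_const_left_commute[of "torus i"])
  also have "\<dots> = ell_const ?e * (ell_const c * a)"
    using assms ell_const_left_commute[of "ell_const c" ?e a] by (simp add: ell_comp_iff)
  finally show "torus i * (ell_const c * a) * torus_inv i = ell_const ?e * (ell_const c * a)" .
qed

lemma ell_comp_cong:
  "deg_l \<alpha> = deg_l \<alpha>' \<Longrightarrow> deg_r \<beta> = deg_r \<beta>' \<Longrightarrow> ell_comp \<alpha> \<beta> = ell_comp \<alpha>' \<beta>'"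
  using weight_eq_iff[of \<alpha> \<beta> \<alpha>' \<beta>'] by (auto simp: ell_comp_iff)

section \<open>Independence of joint eigenvectors modulo an ideal\<close>

lemma two_sided_idealD:
  assumes "two_sided_ideal J" "x \<in> J"
  shows "a * x \<in> J" "x * a \<in> J" "y \<in> J \<Longrightarrow> x + y \<in> J" "y \<in> J \<Longrightarrow> x - y \<in> J"
proof -
  show "a * x \<in> J" "x * a \<in> J"
    using assms unfolding two_sided_ideal_def by blast+
  show add: "x + y \<in> J" if "y \<in> J" for y
    using assms that unfolding two_sided_ideal_def by blast
  show "x - y \<in> J" if "y \<in> J"
  proof -
    have "- 1 * y \<in> J" using assms(1) that unfolding two_sided_ideal_def by blast
    from add[OF this] show ?thesis by simp
  qed
qed

lemma two_sided_ideal_sum: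
  assumes "two_sided_ideal J" "\<And>x. x \<in> S \<Longrightarrow> f x \<in> J"
  shows "sum f S \<in> J"
  using assms(2)
proof (induction S rule: infinite_finite_induct)
  case (insert x S)
  thus ?case using two_sided_idealD(3)[OF assms(1), of "f x" "sum f S"] by simp
qed (use assms(1) in \<open>simp_all add: two_sided_ideal_def\<close>)

text \<open>This is the usual elimination argument: applying an operator minus its eigenvalue at
  \<open>e\<close> to the sum removes \<open>h e\<close> and rescales the other vectors by scalars.
  Two-sidedness of \<open>J\<close> keeps the result in \<open>J\<close>.\<close>

lemma eigenvectors_independent:
  fixes \<kappa> :: "complex fls \<Rightarrow> 'a::ring_1" and u v :: "'i \<Rightarrow> 'a" and ev :: "'i \<Rightarrow> 'd \<Rightarrow> complex fls"
  assumes \<kappa>: "algebra_over \<kappa>" and J: "two_sided_ideal J" and "finite D"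
    and "\<And>d i. d \<in> D \<Longrightarrow> u i * h d * v i = \<kappa> (ev i d) * h d"
    and "\<And>d e. d \<in> D \<Longrightarrow> e \<in> D \<Longrightarrow> d \<noteq> e \<Longrightarrow> \<exists>i. ev i d \<noteq> ev i e"
    and "sum h D \<in> J" "d \<in> D"
  shows "h d \<in> J"
  using assms(3-)
proof (induction D arbitrary: h d rule: finite_induct)
  case (insert e D)
  note Jl = two_sided_idealD(1)[OF J] and Jr = two_sided_idealD(2)[OF J]
    and Jdiff = two_sided_idealD(4)[OF J]
  have \<kappa>m: "\<kappa> (x * y) = \<kappa> x * \<kappa> y" and \<kappa>c: "\<kappa> x * a = a * \<kappa> x" and \<kappa>1: "\<kappa> 1 = 1"
    and \<kappa>a: "\<kappa> (x + y) = \<kappa> x + \<kappa> y" for x y a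
    using \<kappa> unfolding algebra_over_def by blast+
  have \<kappa>d: "\<kappa> (x - y) = \<kappa> x - \<kappa> y" for x y
    using \<kappa>a[of "x - y" y] by simp
  have D: "h x \<in> J" if x: "x \<in> D" for x
  proof -
    have "x \<noteq> e" using x insert.hyps by blast
    then obtain i where i: "ev i x \<noteq> ev i e" using insert.prems(2)[of x e] x by blast
    \<comment> \<open>The index \<open>i\<close> is chosen for this \<open>x\<close>. At other
      \<open>y\<close> the factor may vanish, which is harmless since only \<open>h x\<close> is
      extracted.\<close>
    define h' where "h' = (\<lambda>y. \<kappa> (ev i y - ev i e) * h y)"
    \<comment> \<open>The term at \<open>e\<close> has the factor \<open>\<kappa> 0\<close>, which
      is 0.\<close>
    have "sum h' D = sum h' (insert e D)"
      using insert.hyps \<kappa>d[of 0 0] by (simp add: h'_def)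
    also have "\<dots> = (\<Sum>y\<in>insert e D. u i * h y * v i - \<kappa> (ev i e) * h y)"
      by (rule sum.cong) (simp_all add: h'_def insert.prems(1) \<kappa>d left_diff_distrib)
    also have "\<dots> = u i * sum h (insert e D) * v i - \<kappa> (ev i e) * sum h (insert e D)"
      by (simp only: sum_subtractf sum_distrib_left sum_distrib_right)
    also have "\<dots> \<in> J" using insert.prems(3) by (intro Jdiff Jl Jr)
    finally have sum: "sum h' D \<in> J" .
    have eigen: "u j * h' y * v j = \<kappa> (ev j y) * h' y" if "y \<in> D" for j y
    proof -
      let ?c = "ev i y - ev i e"
      have "u j * (\<kappa> ?c * h y) = \<kappa> ?c * (u j * h y)"
        unfolding mult.assoc[symmetric] \<kappa>c[of ?c "u j"] by (rule refl)
      hence "u j * h' y * v j = \<kappa> ?c * (u j * h y * v j)"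
        unfolding h'_def by (simp only: mult.assoc)
      also have "\<dots> = \<kappa> (?c * ev j y) * h y"
        unfolding insert.prems(1)[OF insertI2[OF that]] \<kappa>m by (simp only: mult.assoc)
      also have "\<dots> = \<kappa> (ev j y) * h' y"
        unfolding h'_def mult.commute[of ?c] \<kappa>m by (simp only: mult.assoc)
      finally show ?thesis .
    qed
    have "h' x \<in> J"
      by (rule insert.IH[OF eigen insert.prems(2) sum x]) simp_all
    hence "\<kappa> (inverse (ev i x - ev i e)) * h' x \<in> J" by (rule Jl)
    moreover have "\<kappa> (inverse (ev i x - ev i e)) * h' x = h x"
      using i unfolding h'_def mult.assoc[symmetric] \<kappa>m[symmetric] by (simp add: \<kappa>1)
    ultimately show ?thesis by simp
  qed
  have "sum h D \<in> J" using D by (rule two_sided_ideal_sum[OF J])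
  hence "sum h (insert e D) - sum h D \<in> J" by (rule Jdiff[OF insert.prems(3)])
  hence "h e \<in> J" using insert.hyps by simp
  thus ?case using insert.prems(4) D by blast
qed simp

lemma two_sided_ideal_p_ell: "two_sided_ideal (range ((*) (p_ell ^ n)))"
proof -
  have "a * (p_ell ^ n * y) = p_ell ^ n * (a * y)" "p_ell ^ n * y * a = p_ell ^ n * (y * a)" for a y :: "'a ell"
    by (metis mult.assoc p_ell_commute)+
  moreover have "p_ell ^ n * y + p_ell ^ n * z = p_ell ^ n * (y + z)" for y z :: "'a ell"
    by (simp add: distrib_left)
  moreover have "(0 :: 'a ell) \<in> range ((*) (p_ell ^ n))" by (rule image_eqI[of _ _ 0]) simp_all
  ultimately show ?thesis unfolding two_sided_ideal_def by auto
qed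

section \<open>Uniqueness of homogeneous decompositions\<close>

definition degrees :: "((complex ^ 'n::finite) \<times> (complex ^ 'n)) set" where
  "degrees = range deg_l \<times> range deg_r"

text \<open>The coset of \<open>a\<close> modulo p^n is an open neighbourhood of \<open>a\<close>,
  so it contains all sufficiently large finite partial sums.\<close>

lemma has_sum_p_adic:
  assumes "(f has_sum (a :: 'n::{finite,linorder} ell)) D"
  obtains E where "finite E" "E \<subseteq> D"
    "\<And>F. finite F \<Longrightarrow> E \<subseteq> F \<Longrightarrow> F \<subseteq> D \<Longrightarrow> sum f F - a \<in> range ((*) (p_ell ^ n))"
proof -
  define U where "U = {x. x - a \<in> range ((*) (p_ell ^ n))}"
  have "open U"
    unfolding open_ell_def
  proof (intro ballI exI allI)
    fix x y assume "x \<in> U"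
    then obtain z where "x - a = p_ell ^ n * z" unfolding U_def by auto
    hence "x + p_ell ^ n * y - a = p_ell ^ n * (z + y)" by (simp add: algebra_simps)
    thus "x + p_ell ^ n * y \<in> U" unfolding U_def by auto
  qed
  moreover have "a \<in> U" unfolding U_def by (auto intro: image_eqI[of _ _ 0])
  ultimately have "\<forall>\<^sub>F F in finite_subsets_at_top D. sum f F \<in> U"
    using assms unfolding has_sum_def by (simp add: topological_tendstoD)
  thus thesis
    using that unfolding eventually_finite_subsets_at_top U_def by auto
qed

text \<open>Modulo p^n both families have the same sum over a large finite set, so their differences
  are eigenvectors summing into the ideal p^n. Independence puts each difference there, for every
  \<open>n\<close>, and \<open>ell_separated\<close> concludes.\<close>

lemma decomposition_unique:
  fixes f g :: "(complex, 'n::{finite,linorder}) vec \<times> (complex, 'n) vec \<Rightarrow> 'n ell"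
  assumes "\<And>\<alpha> \<beta>. f (deg_l \<alpha>, deg_r \<beta>) \<in> ell_comp \<alpha> \<beta>" "\<And>\<alpha> \<beta>. g (deg_l \<alpha>, deg_r \<beta>) \<in> ell_comp \<alpha> \<beta>"
    and "(f has_sum a) degrees" "(g has_sum a) degrees" and d: "d \<in> degrees"
  shows "f d = g d"
proof -
  \<comment> \<open>The families are indexed by restricted degrees, whereas \<open>ell_comp\<close>
    takes elements of H^*; a representative is chosen for each index.\<close>
  have "\<forall>d. \<exists>x :: 'n hw \<times> 'n hw. d \<in> degrees \<longrightarrow> d = (deg_l (fst x), deg_r (snd x))"
  proof
    fix d :: "(complex, 'n) vec \<times> (complex, 'n) vec"
    show "\<exists>x :: 'n hw \<times> 'n hw. d \<in> degrees \<longrightarrow> d = (deg_l (fst x), deg_r (snd x))"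
    proof (cases "d \<in> degrees")
      case True
      then obtain a b :: "'n hw" where "d = (deg_l a, deg_r b)" unfolding degrees_def by blast
      thus ?thesis by (intro exI[of _ "(a, b)"]) simp
    qed simp
  qed
  from choice[OF this] obtain r :: "(complex, 'n) vec \<times> (complex, 'n) vec \<Rightarrow> 'n hw \<times> 'n hw"
    where r: "\<forall>d. d \<in> degrees \<longrightarrow> d = (deg_l (fst (r d)), deg_r (snd (r d)))" by (rule exE)
  define \<alpha> \<beta> where ab_def: "\<alpha> = (\<lambda>d. fst (r d))" "\<beta> = (\<lambda>d. snd (r d))"
  have ab: "d \<in> degrees \<Longrightarrow> d = (deg_l (\<alpha> d), deg_r (\<beta> d))" for d
    unfolding ab_def using r by (rule allE) (erule mp)
  define h where "h = (\<lambda>d. f d - g d)"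
  have h: "h d \<in> ell_comp (\<alpha> d) (\<beta> d)" if "d \<in> degrees" for d
    using ell_comp_closed(4)[OF assms(1)[of "\<alpha> d" "\<beta> d"] assms(2)[of "\<alpha> d" "\<beta> d"]]
    unfolding h_def ab[OF that, symmetric] .
  have "h d = 0"
  proof (rule ell_separated)
    fix n
    let ?J = "range ((*) (p_ell ^ n)) :: 'n ell set"
    obtain E1 where E1: "finite E1" "E1 \<subseteq> degrees"
      "\<And>F. finite F \<Longrightarrow> E1 \<subseteq> F \<Longrightarrow> F \<subseteq> degrees \<Longrightarrow> sum f F - a \<in> ?J"
      using has_sum_p_adic[OF assms(3), where n=n] by metis
    obtain E2 where E2: "finite E2" "E2 \<subseteq> degrees"
      "\<And>F. finite F \<Longrightarrow> E2 \<subseteq> F \<Longrightarrow> F \<subseteq> degrees \<Longrightarrow> sum g F - a \<in> ?J"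
      using has_sum_p_adic[OF assms(4), where n=n] by metis
    \<comment> \<open>Besides making both partial sums accurate modulo p^n, the set must contain the
      degree \<open>d\<close> under consideration.\<close>
    define F where "F = insert d (E1 \<union> E2)"
    have F: "finite F" "F \<subseteq> degrees" using E1 E2 d by (auto simp: F_def)
    have "E1 \<subseteq> F" "E2 \<subseteq> F" by (auto simp: F_def)
    hence "(sum f F - a) - (sum g F - a) \<in> ?J"
      using F by (intro two_sided_idealD(4)[OF two_sided_ideal_p_ell] E1(3) E2(3))
    hence J: "sum h F \<in> ?J" by (simp only: h_def sum_subtractf diff_diff_eq2 diff_add_cancel)
    have "h d \<in> ?J"
    proof (rule eigenvectors_independent[OF algebra_over_ell_const two_sided_ideal_p_ell F(1) _ _ J])
      show "torus i * h e * torus_inv i = ell_const (exp_hbar (weight (\<alpha> e) (\<beta> e) i)) * h e"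
        if "e \<in> F" for e i
        using h[OF subsetD[OF F(2) that]] unfolding ell_comp_iff by blast
      show "\<exists>i. exp_hbar (weight (\<alpha> e) (\<beta> e) i) \<noteq> exp_hbar (weight (\<alpha> e') (\<beta> e') i)"
        if "e \<in> F" "e' \<in> F" "e \<noteq> e'" for e e'
      proof (rule ccontr)
        assume "\<not> ?thesis"
        hence "deg_l (\<alpha> e) = deg_l (\<alpha> e')" "deg_r (\<beta> e) = deg_r (\<beta> e')"
          using weight_eq_iff[of "\<alpha> e" "\<beta> e" "\<alpha> e'" "\<beta> e'"] by (simp_all add: exp_hbar_inject)
        hence "(deg_l (\<alpha> e), deg_r (\<beta> e)) = (deg_l (\<alpha> e'), deg_r (\<beta> e'))" by simp
        hence "e = e'"
          unfolding ab[OF subsetD[OF F(2) \<open>e \<in> F\<close>], symmetric]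
            ab[OF subsetD[OF F(2) \<open>e' \<in> F\<close>], symmetric] .
        thus False using \<open>e \<noteq> e'\<close> by contradiction
      qed
      show "d \<in> F" by (simp add: F_def)
    qed
    thus "\<exists>y. h d = p_ell ^ n * y" by blast
  qed
  thus ?thesis by (simp add: h_def)
qed

section \<open>Existence of homogeneous decompositions\<close>

definition free_part :: "(complex, 'n) vec \<times> (complex, 'n) vec \<Rightarrow> 'n::finite free \<Rightarrow> 'n free" where
  "free_part d F = Abs_fps (\<lambda>m. \<Sum>w\<in>{w\<in>Poly_Mapping.keys (fps_nth F m). word_deg w = d}.
     Poly_Mapping.single w (Poly_Mapping.lookup (fps_nth F m) w))"

lemma keys_free_part: "w \<in> Poly_Mapping.keys (fps_nth (free_part d F) m) \<Longrightarrow> word_deg w = d"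
  using keys_sum by (fastforce simp: free_part_def split: if_splits)

lemma word_deg_degrees: "word_deg w \<in> degrees"
  by (simp add: word_deg_def Let_def degrees_def)

lemma free_part_eq_0: "d \<notin> degrees \<Longrightarrow> free_part d F = 0"
  using word_deg_degrees by (auto simp: free_part_def fps_eq_iff intro!: sum.neutral)

lemma free_part_comp: "abs_ell (free_part (deg_l \<alpha>, deg_r \<beta>) F) \<in> ell_comp \<alpha> \<beta>"
  by (intro ell_compI homogeneous_exchange keys_free_part)

text \<open>Each coefficient is a finite combination of words, so only finitely many degrees occur
  below order \<open>n\<close>. Once these are included, the partial sums agree with
  \<open>F\<close> modulo p^n.\<close>

lemma free_part_has_sum: "((\<lambda>d. abs_ell (free_part d F)) has_sum abs_ell F) degrees"
  unfolding has_sum_def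
proof (rule topological_tendstoI)
  fix U assume "open U" "abs_ell F \<in> U"
  then obtain n where n: "\<And>y. abs_ell F + p_ell ^ n * y \<in> U" unfolding open_ell_def by blast
  define E where "E = (\<Union>m<n. word_deg ` Poly_Mapping.keys (fps_nth F m))"
  have "(\<Sum>d\<in>D. abs_ell (free_part d F)) \<in> U" if D: "finite D" "E \<subseteq> D" for D
  proof -
    have "fps_nth (\<Sum>d\<in>D. free_part d F) m = fps_nth F m" if "m < n" for m
    proof -
      let ?K = "Poly_Mapping.keys (fps_nth F m)"
      have "word_deg ` ?K \<subseteq> D" using D(2) that by (auto simp: E_def)
      \<comment> \<open>The words are grouped by their degrees, all of which lie in
        \<open>D\<close>.\<close>
      hence "fps_nth (\<Sum>d\<in>D. free_part d F) m
          = (\<Sum>w\<in>?K. Poly_Mapping.single w (Poly_Mapping.lookup (fps_nth F m) w))"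
        unfolding fps_sum_nth free_part_def fps_nth_Abs_fps
        by (intro sum.group) (use D in auto)
      thus ?thesis using poly_mapping_sum_single[of "fps_nth F m"] by simp
    qed
    hence "(\<Sum>d\<in>D. free_part d F) - F = fps_X ^ n * fps_shift n ((\<Sum>d\<in>D. free_part d F) - F)"
      by (auto simp: fps_eq_iff fps_X_power_mult_nth)
    hence "abs_ell ((\<Sum>d\<in>D. free_part d F) - F)
        = p_ell ^ n * abs_ell (fps_shift n ((\<Sum>d\<in>D. free_part d F) - F))"
      by (metis abs_ell_hom(2) abs_ell_power p_ell_def)
    hence "(\<Sum>d\<in>D. abs_ell (free_part d F))
        = abs_ell F + p_ell ^ n * abs_ell (fps_shift n ((\<Sum>d\<in>D. free_part d F) - F))"
      by (simp add: abs_ell_hom(3) abs_ell_sum algebra_simps)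
    thus ?thesis using n by metis
  qed
  moreover have "finite E" "E \<subseteq> degrees" using word_deg_degrees by (auto simp: E_def)
  ultimately show "\<forall>\<^sub>F D in finite_subsets_at_top degrees. (\<Sum>d\<in>D. abs_ell (free_part d F)) \<in> U"
    unfolding eventually_finite_subsets_at_top by blast
qed

text \<open>A homogeneous \<open>a\<close> is its own decomposition with a single term. Uniqueness
  equates it with the part of that degree in any representative, and this part consists of words
  with a known exchange rule.\<close>

lemma ell_comp_exchange:
  assumes "a \<in> ell_comp \<alpha> \<beta>"
  shows "mu_l f * a = a * mu_l (fps_map (shift (pt_Ph \<alpha>)) f)"
    "mu_r f * a = a * mu_r (fps_map (shift (pt_P \<beta>)) f)"
proof -
  obtain F where F: "a = abs_ell F" by (rule abs_ell_surj)
  let ?d = "(deg_l \<alpha>, deg_r \<beta>)"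
  define g where "g = (\<lambda>d. if d = ?d then a else 0)"
  have "(g has_sum a) degrees"
    by (rule has_sum_finite_neutralI[of "{?d}"]) (auto simp: g_def degrees_def)
  moreover have "g (deg_l \<alpha>', deg_r \<beta>') \<in> ell_comp \<alpha>' \<beta>'" for \<alpha>' \<beta>'
    using assms ell_comp_cong[of \<alpha> \<alpha>' \<beta> \<beta>'] by (auto simp: g_def ell_comp_closed)
  ultimately have "abs_ell (free_part ?d F) = g ?d"
    using free_part_comp free_part_has_sum[of F] unfolding F
    by (intro decomposition_unique[of "\<lambda>d. abs_ell (free_part d F)" g]) (auto simp: degrees_def)
  hence a: "a = abs_ell (free_part ?d F)" by (simp add: g_def)
  show "mu_l f * a = a * mu_l (fps_map (shift (pt_Ph \<alpha>)) f)"
    "mu_r f * a = a * mu_r (fps_map (shift (pt_P \<beta>)) f)"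
    unfolding a by (rule homogeneous_exchange, rule keys_free_part, assumption)+
qed

lemma bigrading_ell: "bigrading ell_const (ell_comp :: 'n::{finite,linorder} hw \<Rightarrow> 'n hw \<Rightarrow> 'n ell set)"
proof -
  have "\<exists>!f. (\<forall>\<alpha> \<beta>. f (deg_l \<alpha>, deg_r \<beta>) \<in> ell_comp \<alpha> \<beta>) \<and>
      (\<forall>w. w \<notin> degrees \<longrightarrow> f w = 0) \<and> (f has_sum a) degrees" for a :: "'n ell"
  proof -
    obtain F where F: "a = abs_ell F" by (rule abs_ell_surj)
    show ?thesis
    proof (rule ex_ex1I)
      show "\<exists>f. (\<forall>\<alpha> \<beta>. f (deg_l \<alpha>, deg_r \<beta>) \<in> ell_comp \<alpha> \<beta>) \<and>
          (\<forall>w. w \<notin> degrees \<longrightarrow> f w = 0) \<and> (f has_sum a) degrees"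
        unfolding F using free_part_comp free_part_has_sum[of F]
        by (intro exI[of _ "\<lambda>d. abs_ell (free_part d F)"]) (auto simp: free_part_eq_0 abs_ell_hom)
    next
      fix f g :: "(complex, 'n) vec \<times> (complex, 'n) vec \<Rightarrow> 'n ell"
      assume f: "(\<forall>\<alpha> \<beta>. f (deg_l \<alpha>, deg_r \<beta>) \<in> ell_comp \<alpha> \<beta>) \<and>
          (\<forall>w. w \<notin> degrees \<longrightarrow> f w = 0) \<and> (f has_sum a) degrees"
        and g: "(\<forall>\<alpha> \<beta>. g (deg_l \<alpha>, deg_r \<beta>) \<in> ell_comp \<alpha> \<beta>) \<and>
          (\<forall>w. w \<notin> degrees \<longrightarrow> g w = 0) \<and> (g has_sum a) degrees"
      have "f d = g d" if "d \<in> degrees" for d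
        using that by (rule decomposition_unique[OF f[THEN conjunct1, rule_format]
            g[THEN conjunct1, rule_format] f[THEN conjunct2, THEN conjunct2]
            g[THEN conjunct2, THEN conjunct2]])
      moreover have "f d = g d" if "d \<notin> degrees" for d
        using f[THEN conjunct2, THEN conjunct1, rule_format, OF that]
          g[THEN conjunct2, THEN conjunct1, rule_format, OF that] by (simp only:)
      ultimately show "f = g" by blast
    qed
  qed
  thus ?thesis
    unfolding bigrading_def degrees_def[symmetric]
    by (intro conjI allI ballI impI ell_comp_closed ell_comp_scale ell_comp_mult ell_comp_cong)
qed

theorem proposition4p4:
  assumes "CARD('n::{finite,linorder}) \<ge> 2"
  shows "H_algebra ell_const (ell_comp :: 'n hw \<Rightarrow> 'n hw \<Rightarrow> 'n ell set) mu_l mu_r \<and>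
    (\<forall>(i::'n) j n. Lbar i j n \<in> ell_comp (- Q_dyn (ebar i)) (- Q_dyn (ebar j)))"
proof
  show "H_algebra ell_const (ell_comp :: 'n hw \<Rightarrow> 'n hw \<Rightarrow> 'n ell set) mu_l mu_r"
    unfolding H_algebra_def algebra_embedding_def
    by (intro conjI allI ballI algebra_over_ell_const bigrading_ell mu_l_inj mu_r_inj mu_l_hom mu_r_hom
        mu_ground_const range_mu ell_comp_exchange)
  show "\<forall>(i::'n) j n. Lbar i j n \<in> ell_comp (- Q_dyn (ebar i)) (- Q_dyn (ebar j))"
    \<comment> \<open>The representative is a one-letter word at order 0, and its higher
      coefficients contain no words, so homogeneity is read off from \<open>gen_deg\<close>.\<close>
    unfolding Lbar_def
    by (intro allI ell_compI homogeneous_exchange; simp add: gen_elt_def word_deg_def split: if_splits)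
qed

end
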